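(* Let $n\ge 3$ and let $D$ be a distance on the symmetric group $Sym(n)$ which is bi-invariant and distinguishes the transpositions. Then the group $Iso_D$ of all isometries of the metric space $(Sym(n),D)$ is $(\mathcal{L}\times\mathcal{R})\rtimes\mathcal{I}$, and this group is isomorphic to the wreath product $Sym(n)\wr 2$.
   Context: A distance $D$ on $Sym(n)$ is left-invariant if $D(\phi,\psi)=D(\alpha\phi,\alpha\psi)$ for all $\alpha,\phi,\psi\in Sym(n)$, right-invariant if $D(\phi,\psi)=D(\phi\alpha,\psi\alpha)$ for all $\alpha,\phi,\psi$, and bi-invariant if it is both. $D$ distinguishes the transpositions if there is a constant $c$ such that for all $\phi,\psi\in Sym(n)$: $D(\phi,\psi)=c$ if and only if $\phi\psi^{-1}$ is a transposition. An isometry of $(Sym(n),D)$ is a bijection $t:Sym(n)\to Sym(n)$ with $D(t(\phi),t(\psi))=D(\phi,\psi)$ for all $\phi,\psi$. $\mathcal{L}=\{l_\alpha:\alpha\in Sym(n)\}$ is the group of left multiplications $l_\alpha:\phi\mapsto\alpha\phi$, $\mathcal{R}=\{r_\alpha:\alpha\in Sym(n)\}$ is the group of right multiplications $r_\alpha:\phi\mapsto\phi\alpha^{-1}$, and $\mathcal{I}$ is the group of order 2 generated by the inversion map $\phi\mapsto\phi^{-1}$. *)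

theory Defs
  imports
    "HOL-Algebra.Sym_Groups"
    "HOL-Algebra.Product_Groups"
    "HOL-Algebra.Bij"
    "HOL-Analysis.Abstract_Metric_Spaces"
begin

subsection \<open>Invariant distances\<close>

definition left_invariant :: "('a, 'm) monoid_scheme \<Rightarrow> ('a \<Rightarrow> 'a \<Rightarrow> real) \<Rightarrow> bool" where
  "left_invariant G D \<longleftrightarrow>
     (\<forall>\<alpha>\<in>carrier G. \<forall>\<phi>\<in>carrier G. \<forall>\<psi>\<in>carrier G.
        D \<phi> \<psi> = D (\<alpha> \<otimes>\<^bsub>G\<^esub> \<phi>) (\<alpha> \<otimes>\<^bsub>G\<^esub> \<psi>))"

definition right_invariant :: "('a, 'm) monoid_scheme \<Rightarrow> ('a \<Rightarrow> 'a \<Rightarrow> real) \<Rightarrow> bool" where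
  "right_invariant G D \<longleftrightarrow>
     (\<forall>\<alpha>\<in>carrier G. \<forall>\<phi>\<in>carrier G. \<forall>\<psi>\<in>carrier G.
        D \<phi> \<psi> = D (\<phi> \<otimes>\<^bsub>G\<^esub> \<alpha>) (\<psi> \<otimes>\<^bsub>G\<^esub> \<alpha>))"

definition bi_invariant :: "('a, 'm) monoid_scheme \<Rightarrow> ('a \<Rightarrow> 'a \<Rightarrow> real) \<Rightarrow> bool" where
  "bi_invariant G D \<longleftrightarrow> left_invariant G D \<and> right_invariant G D"

definition is_transposition :: "nat \<Rightarrow> (nat \<Rightarrow> nat) \<Rightarrow> bool" where
  "is_transposition n \<pi> \<longleftrightarrow>
     (\<exists>a\<in>{1..n}. \<exists>b\<in>{1..n}. a \<noteq> b \<and> \<pi> = Transposition.transpose a b)"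

definition distinguishes_transpositions ::
  "nat \<Rightarrow> ((nat \<Rightarrow> nat) \<Rightarrow> (nat \<Rightarrow> nat) \<Rightarrow> real) \<Rightarrow> bool" where
  "distinguishes_transpositions n D \<longleftrightarrow>
     (\<exists>c. \<forall>\<phi>\<in>carrier (sym_group n). \<forall>\<psi>\<in>carrier (sym_group n).
        D \<phi> \<psi> = c \<longleftrightarrow>
        is_transposition n (\<phi> \<otimes>\<^bsub>sym_group n\<^esub> inv\<^bsub>sym_group n\<^esub> \<psi>))"

subsection \<open>The isometry group and its distinguished subgroups\<close>

text \<open>As in \<^const>\<open>BijGroup\<close>, self-maps of \<open>S\<close> are represented by functions that
  are \<^const>\<open>undefined\<close> outside \<open>S\<close>, and the product of \<open>g\<close> and \<open>f\<close> applies \<open>f\<close> first.\<close>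

definition isometry_group :: "'a set \<Rightarrow> ('a \<Rightarrow> 'a \<Rightarrow> real) \<Rightarrow> ('a \<Rightarrow> 'a) monoid" where
  "isometry_group S D =
     (BijGroup S)\<lparr>carrier := {t \<in> Bij S. \<forall>x\<in>S. \<forall>y\<in>S. D (t x) (t y) = D x y}\<rparr>"

definition left_multiplications :: "('a, 'm) monoid_scheme \<Rightarrow> ('a \<Rightarrow> 'a) set" where
  "left_multiplications G =
     (\<lambda>\<alpha>. \<lambda>\<phi>\<in>carrier G. \<alpha> \<otimes>\<^bsub>G\<^esub> \<phi>) ` carrier G"

definition right_multiplications :: "('a, 'm) monoid_scheme \<Rightarrow> ('a \<Rightarrow> 'a) set" where
  "right_multiplications G =
     (\<lambda>\<alpha>. \<lambda>\<phi>\<in>carrier G. \<phi> \<otimes>\<^bsub>G\<^esub> inv\<^bsub>G\<^esub> \<alpha>) ` carrier G"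

definition inversion_map :: "('a, 'm) monoid_scheme \<Rightarrow> 'a \<Rightarrow> 'a" where
  "inversion_map G = (\<lambda>\<phi>\<in>carrier G. inv\<^bsub>G\<^esub> \<phi>)"

definition inversion_group :: "('a, 'm) monoid_scheme \<Rightarrow> ('a \<Rightarrow> 'a) set" where
  "inversion_group G = generate (BijGroup (carrier G)) {inversion_map G}"

subsection \<open>Direct, semidirect and wreath products\<close>

definition is_internal_direct_product ::
  "('a, 'm) monoid_scheme \<Rightarrow> 'a set \<Rightarrow> 'a set \<Rightarrow> bool" where
  "is_internal_direct_product G H K \<longleftrightarrow>
     H \<lhd> G \<and> K \<lhd> G \<and> H \<inter> K = {\<one>\<^bsub>G\<^esub>} \<and> H <#>\<^bsub>G\<^esub> K = carrier G"

definition is_internal_semidirect_product ::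
  "('a, 'm) monoid_scheme \<Rightarrow> 'a set \<Rightarrow> 'a set \<Rightarrow> bool" where
  "is_internal_semidirect_product G N H \<longleftrightarrow>
     N \<lhd> G \<and> subgroup H G \<and> N \<inter> H = {\<one>\<^bsub>G\<^esub>} \<and> N <#>\<^bsub>G\<^esub> H = carrier G"

definition semidirect_product ::
  "('a, 'm) monoid_scheme \<Rightarrow> ('b, 'k) monoid_scheme \<Rightarrow> ('b \<Rightarrow> 'a \<Rightarrow> 'a) \<Rightarrow> ('a \<times> 'b) monoid" where
  "semidirect_product N H \<theta> =
     \<lparr>carrier = carrier N \<times> carrier H,
      mult = (\<lambda>(x, h) (y, k). (x \<otimes>\<^bsub>N\<^esub> \<theta> h y, h \<otimes>\<^bsub>H\<^esub> k)),
      one = (\<one>\<^bsub>N\<^esub>, \<one>\<^bsub>H\<^esub>)\<rparr>"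

text \<open>The wreath product of \<open>G\<close> with \<open>Sym(m)\<close>, acting on \<open>G\<^sup>m\<close> by permuting the \<open>m\<close>
  coordinates. The inverse makes this a left action. For \<open>m = 2\<close> the top group is the cyclic
  group of order 2, interchanging the two factors of \<open>G \<times> G\<close>.\<close>

definition wreath_action :: "('a, 'm) monoid_scheme \<Rightarrow> nat \<Rightarrow> (nat \<Rightarrow> nat) \<Rightarrow> (nat \<Rightarrow> 'a) \<Rightarrow> (nat \<Rightarrow> 'a)"
  where
  "wreath_action G m \<sigma> =
     (\<lambda>f\<in>carrier (product_group {1..m} (\<lambda>_. G)). \<lambda>i\<in>{1..m}. f ((inv\<^bsub>sym_group m\<^esub> \<sigma>) i))"

definition wreath_product ::
  "('a, 'm) monoid_scheme \<Rightarrow> nat \<Rightarrow> ((nat \<Rightarrow> 'a) \<times> (nat \<Rightarrow> nat)) monoid" where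
  "wreath_product G m =
     semidirect_product (product_group {1..m} (\<lambda>_. G)) (sym_group m) (wreath_action G m)"

subsection \<open>Well-definedness\<close>

lemma group_isometry_group: "group (isometry_group S D)"
proof -
  interpret B: group "BijGroup S" by (rule group_BijGroup)
  let ?I = "{t \<in> Bij S. \<forall>x\<in>S. \<forall>y\<in>S. D (t x) (t y) = D x y}"
  have "subgroup ?I (BijGroup S)"
  proof (rule B.subgroupI)
    show "?I \<subseteq> carrier (BijGroup S)" by (auto simp: BijGroup_def)
    have "(\<lambda>x\<in>S. x) \<in> ?I" by (simp add: id_Bij)
    then show "?I \<noteq> {}" by blast
  next
    fix t assume t: "t \<in> ?I"
    then have bij: "bij_betw t S S" and tB: "t \<in> Bij S" by (auto simp: Bij_def)
    have inv: "inv\<^bsub>BijGroup S\<^esub> t = (\<lambda>x\<in>S. inv_into S t x)"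
      using tB by (rule inv_BijGroup)
    have "D (inv_into S t x) (inv_into S t y) = D x y" if "x \<in> S" "y \<in> S" for x y
    proof -
      have "inv_into S t x \<in> S" "inv_into S t y \<in> S"
        using tB that by (auto intro: Bij_inv_into_mem)
      then have "D (t (inv_into S t x)) (t (inv_into S t y)) = D (inv_into S t x) (inv_into S t y)"
        using t by blast
      then show ?thesis using bij that by (simp add: bij_betw_inv_into_right)
    qed
    then show "inv\<^bsub>BijGroup S\<^esub> t \<in> ?I"
      using tB by (simp add: inv restrict_inv_into_Bij)
  next
    fix s t assume "s \<in> ?I" "t \<in> ?I"
    then show "s \<otimes>\<^bsub>BijGroup S\<^esub> t \<in> ?I"
      using Bij_imp_funcset[of t S] by (auto simp: BijGroup_def compose_Bij compose_eq Pi_iff)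
  qed
  then show ?thesis
    unfolding isometry_group_def by (rule B.subgroup_imp_group)
qed

lemma group_semidirect_product:
  assumes N: "group N" and H: "group H" and \<theta>: "\<theta> \<in> hom H (AutoGroup N)"
  shows "group (semidirect_product N H \<theta>)"
proof -
  interpret N: group N by fact
  interpret H: group H by fact
  have auto: "\<theta> h \<in> auto N" if "h \<in> carrier H" for h
    using \<theta> that by (auto simp: hom_def AutoGroup_def)
  have cl: "\<theta> h x \<in> carrier N" if "h \<in> carrier H" "x \<in> carrier N" for h x
    using auto[OF that(1)] that(2) by (auto simp: auto_def hom_def)
  have mul: "\<theta> h (x \<otimes>\<^bsub>N\<^esub> y) = \<theta> h x \<otimes>\<^bsub>N\<^esub> \<theta> h y"
    if "h \<in> carrier H" "x \<in> carrier N" "y \<in> carrier N" for h x y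
    using auto[OF that(1)] that(2,3) by (auto simp: auto_def hom_def)
  have comp: "\<theta> (h \<otimes>\<^bsub>H\<^esub> k) x = \<theta> h (\<theta> k x)"
    if "h \<in> carrier H" "k \<in> carrier H" "x \<in> carrier N" for h k x
    using \<theta> that auto[OF that(1)] auto[OF that(2)]
    by (auto simp: hom_def AutoGroup_def BijGroup_def auto_def compose_eq)
  interpret A: group "AutoGroup N" by (rule N.AutoGroup)
  have "\<theta> \<one>\<^bsub>H\<^esub> = \<one>\<^bsub>AutoGroup N\<^esub>"
    using \<theta> H by (intro hom_one) (auto intro: A.is_group)
  then have one: "\<theta> \<one>\<^bsub>H\<^esub> x = x" if "x \<in> carrier N" for x
    using that by (simp add: AutoGroup_def BijGroup_def)
  show ?thesis
  proof (rule groupI)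
    fix p assume "p \<in> carrier (semidirect_product N H \<theta>)"
    then obtain x h where p: "p = (x, h)" "x \<in> carrier N" "h \<in> carrier H"
      by (auto simp: semidirect_product_def)
    let ?q = "(\<theta> (inv\<^bsub>H\<^esub> h) (inv\<^bsub>N\<^esub> x), inv\<^bsub>H\<^esub> h)"
    have "\<theta> (inv\<^bsub>H\<^esub> h) \<one>\<^bsub>N\<^esub> = \<one>\<^bsub>N\<^esub>"
      using mul[of "inv\<^bsub>H\<^esub> h" "\<one>\<^bsub>N\<^esub>" "\<one>\<^bsub>N\<^esub>"] cl[of "inv\<^bsub>H\<^esub> h" "\<one>\<^bsub>N\<^esub>"] p
      by (metis H.inv_closed N.l_cancel_one' N.l_one N.one_closed)
    then have "?q \<otimes>\<^bsub>semidirect_product N H \<theta>\<^esub> p = \<one>\<^bsub>semidirect_product N H \<theta>\<^esub>"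
      using p mul[of "inv\<^bsub>H\<^esub> h" "inv\<^bsub>N\<^esub> x" x] by (simp add: semidirect_product_def)
    then show "\<exists>q\<in>carrier (semidirect_product N H \<theta>).
        q \<otimes>\<^bsub>semidirect_product N H \<theta>\<^esub> p = \<one>\<^bsub>semidirect_product N H \<theta>\<^esub>"
      using p by (intro bexI[of _ ?q]) (auto simp: semidirect_product_def cl)
  qed (auto simp: semidirect_product_def cl mul comp one N.m_assoc H.m_assoc)
qed

lemma group_wreath_product:
  assumes G: "group G"
  shows "group (wreath_product G m)"
proof -
  let ?P = "product_group {1..m} (\<lambda>_. G)" and ?S = "sym_group m"
  interpret G: group G by fact
  interpret S: group ?S by (rule sym_group_is_group)
  have P: "group ?P" by (simp add: G)
  have mem: "s i \<in> {1..m}" if "s \<in> carrier ?S" "i \<in> {1..m}" for s i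
    using that permutes_in_image[of s "{1..m}" i] by (simp only: sym_group_carrier)
  have cl: "wreath_action G m s f \<in> carrier ?P" if "s \<in> carrier ?S" "f \<in> carrier ?P" for s f
    using that mem[OF S.inv_closed[OF that(1)]]
    by (auto simp: wreath_action_def PiE_iff simp del: sym_group_inv_equality)
  have comp: "wreath_action G m (s \<otimes>\<^bsub>?S\<^esub> t) f = wreath_action G m s (wreath_action G m t f)"
    if "s \<in> carrier ?S" "t \<in> carrier ?S" "f \<in> carrier ?P" for s t f
  proof -
    have "wreath_action G m (s \<otimes>\<^bsub>?S\<^esub> t) f
        = (\<lambda>i\<in>{1..m}. f ((inv\<^bsub>?S\<^esub> t \<otimes>\<^bsub>?S\<^esub> inv\<^bsub>?S\<^esub> s) i))"
      using that unfolding wreath_action_def by (simp only: S.inv_mult_group restrict_apply' )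
    also have "\<dots> = (\<lambda>i\<in>{1..m}. wreath_action G m t f ((inv\<^bsub>?S\<^esub> s) i))"
    proof (rule restrict_ext)
      fix i assume "i \<in> {1..m}"
      then have "(inv\<^bsub>?S\<^esub> s) i \<in> {1..m}" using mem S.inv_closed that(1) by blast
      then show "f ((inv\<^bsub>?S\<^esub> t \<otimes>\<^bsub>?S\<^esub> inv\<^bsub>?S\<^esub> s) i) = wreath_action G m t f ((inv\<^bsub>?S\<^esub> s) i)"
        using that(3) unfolding wreath_action_def
        by (simp only: restrict_apply' sym_group_mult o_apply)
    qed
    also have "\<dots> = wreath_action G m s (wreath_action G m t f)"
      unfolding wreath_action_def[of G m s] by (simp only: restrict_apply' cl[OF that(2,3)])
    finally show ?thesis .
  qed
  have one: "wreath_action G m \<one>\<^bsub>?S\<^esub> f = f" if "f \<in> carrier ?P" for f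
    using that unfolding wreath_action_def
    by (simp only: S.inv_one restrict_apply')
       (auto simp: sym_group_one PiE_iff extensional_def fun_eq_iff)
  have mul: "wreath_action G m s (f \<otimes>\<^bsub>?P\<^esub> g) = wreath_action G m s f \<otimes>\<^bsub>?P\<^esub> wreath_action G m s g"
    if s: "s \<in> carrier ?S" and f: "f \<in> carrier ?P" and g: "g \<in> carrier ?P" for s f g
  proof -
    have fg: "f \<otimes>\<^bsub>?P\<^esub> g \<in> carrier ?P"
      using P f g by (simp only: group.is_monoid monoid.m_closed)
    show ?thesis
      using mem[OF S.inv_closed[OF s]] unfolding wreath_action_def
      by (simp only: restrict_apply' f g fg)
         (auto simp: fun_eq_iff simp del: sym_group_inv_equality)
  qed
  have bij: "bij_betw (wreath_action G m s) (carrier ?P) (carrier ?P)" if "s \<in> carrier ?S" for s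
  proof (rule bij_betw_byWitness[where f' = "wreath_action G m (inv\<^bsub>?S\<^esub> s)"])
    show "\<forall>f\<in>carrier ?P. wreath_action G m (inv\<^bsub>?S\<^esub> s) (wreath_action G m s f) = f"
      using that by (metis S.inv_closed S.l_inv comp one)
    show "\<forall>f\<in>carrier ?P. wreath_action G m s (wreath_action G m (inv\<^bsub>?S\<^esub> s) f) = f"
      using that by (metis S.inv_closed S.r_inv comp one)
  qed (use that cl S.inv_closed in blast)+
  have ext: "wreath_action G m s \<in> extensional (carrier ?P)" for s
    unfolding wreath_action_def by (rule restrict_extensional)
  have aut: "wreath_action G m s \<in> auto ?P" if "s \<in> carrier ?S" for s
    unfolding auto_def Bij_def hom_def using that bij ext cl mul by blast
  have "wreath_action G m \<in> hom ?S (AutoGroup ?P)"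
  proof (rule homI)
    show "wreath_action G m s \<in> carrier (AutoGroup ?P)" if "s \<in> carrier ?S" for s
      using aut[OF that] by (simp add: AutoGroup_def)
    fix s t assume st: "s \<in> carrier ?S" "t \<in> carrier ?S"
    have "wreath_action G m (s \<otimes>\<^bsub>?S\<^esub> t)
        = compose (carrier ?P) (wreath_action G m s) (wreath_action G m t)"
      by (rule extensionalityI[OF ext compose_extensional]) (simp only: compose_eq comp st)
    moreover have "wreath_action G m s \<in> Bij (carrier ?P)" "wreath_action G m t \<in> Bij (carrier ?P)"
      using aut st by (auto simp: auto_def)
    ultimately show "wreath_action G m (s \<otimes>\<^bsub>?S\<^esub> t)
        = wreath_action G m s \<otimes>\<^bsub>AutoGroup ?P\<^esub> wreath_action G m t"
      by (simp add: AutoGroup_def BijGroup_def)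
  qed
  then show ?thesis
    unfolding wreath_product_def
    by (intro group_semidirect_product P sym_group_is_group)
qed

lemma card_inversion_group:
  assumes "n \<ge> 3"
  shows "card (inversion_group (sym_group n)) = 2"
proof -
  let ?S = "sym_group n" and ?j = "inversion_map (sym_group n)"
  let ?B = "BijGroup (carrier ?S)"
  interpret S: group ?S by (rule sym_group_is_group)
  interpret B: group ?B by (rule group_BijGroup)
  have "bij_betw ?j (carrier ?S) (carrier ?S)"
    by (rule bij_betw_byWitness[where f' = ?j])
       (auto simp: inversion_map_def simp del: sym_group_inv_equality)
  then have jB: "?j \<in> Bij (carrier ?S)" by (simp add: Bij_def inversion_map_def)
  then have j: "?j \<in> carrier ?B" by (simp add: BijGroup_def)
  have jj: "?j \<otimes>\<^bsub>?B\<^esub> ?j = \<one>\<^bsub>?B\<^esub>"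
    using jB by (auto simp: BijGroup_def inversion_map_def compose_def fun_eq_iff
        simp del: sym_group_inv_equality)
  then have inv: "inv\<^bsub>?B\<^esub> ?j = ?j" using j by (simp add: B.inv_equality)
  have "x \<in> {\<one>\<^bsub>?B\<^esub>, ?j}" if "x \<in> generate ?B {?j}" for x
    using that by (induction rule: generate.induct) (use j jj inv in auto)
  then have gen: "generate ?B {?j} = {\<one>\<^bsub>?B\<^esub>, ?j}"
    by (auto intro: generate.intros)
  let ?a = "Transposition.transpose (1::nat) 2" and ?b = "Transposition.transpose (2::nat) 3"
  have a: "?a \<in> carrier ?S" and b: "?b \<in> carrier ?S"
    using assms by (auto simp: sym_group_carrier intro!: permutes_swap_id)
  have "?j \<noteq> \<one>\<^bsub>?B\<^esub>"
  proof
    assume "?j = \<one>\<^bsub>?B\<^esub>"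
    then have id: "inv\<^bsub>?S\<^esub> x = x" if "x \<in> carrier ?S" for x
      using that by (metis BijGroup_def inversion_map_def monoid.select_convs(2) restrict_apply')
    have "?a \<otimes>\<^bsub>?S\<^esub> ?b = ?b \<otimes>\<^bsub>?S\<^esub> ?a"
      using a b id by (metis S.inv_mult_group S.m_closed)
    then have "(?a \<circ> ?b) 1 = (?b \<circ> ?a) 1" by (simp add: sym_group_mult)
    then show False by (simp add: Transposition.transpose_def)
  qed
  then show ?thesis unfolding inversion_group_def gen by simp
qed

end

(*
An isometry preserves the pairs at distance c, so it is an automorphism of the Cayley graph of
Sym(n) with respect to all transpositions. Let t be such an automorphism with t(1) = 1. A product
s w of two transpositions is adjacent to s and to w, which forces t(s w) to be t(s) t(w) or
t(w) t(s). Hence t permutes the transpositions, preserves pairs that do not commute, and maps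
s w s to t(s) t(w) t(s), so on transpositions t is conjugation by a point permutation.

After composing with this conjugation, t fixes every transposition. For each transposition s,
the twisted automorphism x |-> s t(s x) also acts on transpositions by a point permutation, which
has to be 1 or s; so t(s w) = s w for all w, or t(s w) = w s for all w. The same alternative holds
for all s, since non-commuting s and w share the product s w. In the first case the twisted
automorphisms are of the same kind, and induction on the number of transposition factors gives
t = 1; in the second case inversion composed with t is of the first kind.
*)
theory Submission
  imports Defs
begin

hide_const (open) Finite_Cartesian_Product.transpose

subsection \<open>Products of two transpositions\<close>

definition transpositions :: "'a set \<Rightarrow> ('a \<Rightarrow> 'a) set" where
  "transpositions A = {transpose a b |a b. a \<in> A \<and> b \<in> A \<and> a \<noteq> b}"

lemma transpositionsI:
  "a \<in> A \<Longrightarrow> b \<in> A \<Longrightarrow> a \<noteq> b \<Longrightarrow> transpose a b \<in> transpositions A"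
  unfolding transpositions_def by blast

lemma transpositionsE:
  assumes "s \<in> transpositions A"
  obtains a b where "a \<in> A" "b \<in> A" "a \<noteq> b" "s = transpose a b"
  using assms unfolding transpositions_def by blast

lemma transpositions_mono: "s \<in> transpositions A \<Longrightarrow> s \<in> transpositions UNIV"
  unfolding transpositions_def by blast

lemma transposition_permutes: "s \<in> transpositions A \<Longrightarrow> s permutes A"
  by (auto elim!: transpositionsE intro: permutes_swap_id)

lemma transposition_involution: "s \<in> transpositions A \<Longrightarrow> s \<circ> s = id"
  by (auto elim!: transpositionsE)

lemma transposition_cancel_left: "s \<in> transpositions A \<Longrightarrow> s \<circ> (s \<circ> p) = p"
  by (auto elim!: transpositionsE simp: fun_eq_iff)

lemma transposition_inv: "s \<in> transpositions A \<Longrightarrow> inv' s = s"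
  by (auto elim!: transpositionsE)

lemma transposition_moves_two:
  assumes "s \<in> transpositions UNIV" "s x = y" "x \<noteq> y"
  shows "s = transpose x y"
proof -
  obtain a b where s: "s = transpose a b" using assms(1) by (rule transpositionsE)
  consider "x = a" | "x = b" | "x \<noteq> a" "x \<noteq> b" by blast
  then show ?thesis
  proof cases
    case 2
    then show ?thesis using s assms(2) by (simp add: transpose_commute[of a b])
  qed (use s assms in auto)
qed

lemma transpose_conjugate:
  assumes "p permutes A"
  shows "p \<circ> transpose a b \<circ> inv' p = transpose (p a) (p b)"
proof
  fix x
  have "inv' p x = a \<longleftrightarrow> x = p a" "inv' p x = b \<longleftrightarrow> x = p b"
    using permutes_inv_eq[OF assms] by metis+
  then show "(p \<circ> transpose a b \<circ> inv' p) x = transpose (p a) (p b) x"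
    using permutes_inverses(1)[OF assms] by (auto simp: Transposition.transpose_def)
qed

lemma transpositions_conjugate:
  assumes "s \<in> transpositions A" "p permutes A"
  shows "p \<circ> s \<circ> inv' p \<in> transpositions A"
  using assms permutes_in_image[OF assms(2)] permutes_inj[OF assms(2)]
  by (elim transpositionsE) (auto simp: transpose_conjugate inj_eq intro!: transpositionsI)

section \<open>When two transpositions commute\<close>

lemma noncommuting_transposesI:
  "a \<noteq> b \<Longrightarrow> b \<noteq> c \<Longrightarrow> a \<noteq> c \<Longrightarrow> transpose a b \<circ> transpose b c \<noteq> transpose b c \<circ> transpose a b"
  by (rule notI, drule fun_cong[where x = b]) simp

lemma transpose_eq_transpose_iff:
  assumes "a \<noteq> b"
  shows "transpose a b = transpose c d \<longleftrightarrow> {a, b} = {c, d}"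
proof
  assume eq: "transpose a b = transpose c d"
  have moved: "{x. transpose i j x \<noteq> x} = {i, j}" if "i \<noteq> j" for i j :: 'a
    using that by (auto simp: Transposition.transpose_def)
  \<comment> \<open>\<open>transpose c c\<close> is the identity, so a degenerate right-hand side
    cannot equal \<open>transpose a b\<close>.\<close>
  have "c \<noteq> d" using eq assms transpose_eq_id_iff[of a b] by auto
  then show "{a, b} = {c, d}" using moved[of a b] moved[of c d] assms eq by simp
qed (auto simp: doubleton_eq_iff transpose_commute)

text \<open>The only obstruction is overlap in exactly one point: the two products are then the two
  mutually inverse 3-cycles on the three points involved.\<close>

lemma transposes_commute_iff:
  assumes "a \<noteq> b" "c \<noteq> d"
  shows "transpose a b \<circ> transpose c d = transpose c d \<circ> transpose a b \<longleftrightarrow>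
    {a, b} = {c, d} \<or> {a, b} \<inter> {c, d} = {}" (is "?C \<longleftrightarrow> ?E \<or> ?D")
proof
  assume C: ?C
  show "?E \<or> ?D"
  proof (rule ccontr)
    assume "\<not> (?E \<or> ?D)"
    then consider "b = c" "a \<noteq> d" | "b = d" "a \<noteq> c" | "a = c" "b \<noteq> d" | "a = d" "b \<noteq> c"
      by auto
    then show False
      using C noncommuting_transposesI[of a b d] noncommuting_transposesI[of a b c]
        noncommuting_transposesI[of b a d] noncommuting_transposesI[of b a c] assms
      by cases (simp_all add: transpose_commute)
  qed
next
  assume "?E \<or> ?D"
  then show ?C
  proof
    assume ?E
    then show ?C by (auto simp: doubleton_eq_iff transpose_commute)
  next
    assume ?D
    then show ?C by (auto simp: fun_eq_iff Transposition.transpose_def)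
  qed
qed

text \<open>The four ways in which two pairs can share exactly one point are relabelled so that the
  shared point is always \<open>b\<close>; later computations need only this normal form.\<close>

lemma noncommuting_transpositionsE:
  assumes "s \<in> transpositions A" "w \<in> transpositions A" "s \<circ> w \<noteq> w \<circ> s"
  obtains a b c where "a \<in> A" "b \<in> A" "c \<in> A" "a \<noteq> b" "b \<noteq> c" "a \<noteq> c"
    "s = transpose a b" "w = transpose b c"
proof -
  obtain a b where ab: "a \<in> A" "b \<in> A" "a \<noteq> b" "s = transpose a b" using assms(1) by (rule transpositionsE)
  obtain c d where cd: "c \<in> A" "d \<in> A" "c \<noteq> d" "w = transpose c d" using assms(2) by (rule transpositionsE)
  have "{a, b} \<noteq> {c, d}" "{a, b} \<inter> {c, d} \<noteq> {}"
    using assms(3) transposes_commute_iff[of a b c d] ab cd by auto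
  then consider "b = c" "a \<noteq> d" | "b = d" "a \<noteq> c" | "a = c" "b \<noteq> d" | "a = d" "b \<noteq> c"
    by auto
  then show thesis
  proof cases
    case 1
    show thesis
      by (rule that[of a b d]) (use 1 ab cd in \<open>auto simp: transpose_commute\<close>)
  next
    case 2
    show thesis
      by (rule that[of a b c]) (use 2 ab cd in \<open>auto simp: transpose_commute\<close>)
  next
    case 3
    show thesis
      by (rule that[of b a d]) (use 3 ab cd in \<open>auto simp: transpose_commute\<close>)
  next
    case 4
    show thesis
      by (rule that[of b a c]) (use 4 ab cd in \<open>auto simp: transpose_commute\<close>)
  qed
qed

text \<open>For \<open>s = transpose a b\<close> and \<open>w = transpose b c\<close>, both sides
  are the third transposition \<open>transpose a c\<close>.\<close>

lemma braid_transpositions: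
  assumes "s \<in> transpositions A" "w \<in> transpositions A" "s \<circ> w \<noteq> w \<circ> s"
  shows "s \<circ> w \<circ> s = w \<circ> s \<circ> w"
  by (rule noncommuting_transpositionsE[OF assms])
    (metis transpose_comp_triple transpose_commute)

text \<open>A transposition \<open>u\<close> that occurs in a factorisation \<open>v u\<close> of \<open>g\<close> into two transpositions
  only moves points moved by \<open>g\<close>, unless \<open>u = v\<close>.\<close>

lemma factorisations_of_product:
  assumes T: "s \<in> transpositions UNIV" "w \<in> transpositions UNIV"
    "u \<in> transpositions UNIV" "v \<in> transpositions UNIV"
    and "s \<noteq> w" and eq: "v \<circ> u = w \<circ> s"
  shows "u \<in> {s, w, s \<circ> w \<circ> s}"
proof -
  obtain x y where xy: "x \<noteq> y" "u = transpose x y" using T(3) by (rule transpositionsE)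
  obtain a b where ab: "a \<noteq> b" "s = transpose a b" using T(1) by (rule transpositionsE)
  obtain c d where cd: "c \<noteq> d" "w = transpose c d" using T(2) by (rule transpositionsE)
  have ne: "w \<circ> s \<noteq> id"
    using \<open>s \<noteq> w\<close> transposition_cancel_left[OF T(2), of s] by auto
  then have "u \<noteq> v" using eq transposition_involution[OF T(3)] by auto
  \<comment> \<open>If \<open>w \<circ> s\<close> fixed \<open>x\<close>, then \<open>v\<close>
    would send \<open>y\<close> back to \<open>x\<close> and so equal \<open>u\<close>; likewise
    with \<open>x\<close> and \<open>y\<close> exchanged.\<close>
  have moved: "(w \<circ> s) x \<noteq> x" "(w \<circ> s) y \<noteq> y"
    using transposition_moves_two[OF T(4), of y x] transposition_moves_two[OF T(4), of x y]
      fun_cong[OF eq, of x] fun_cong[OF eq, of y] xy \<open>u \<noteq> v\<close>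
    by (auto simp: transpose_commute)
  have xm: "x \<in> {a, b, c, d}" and ym: "y \<in> {a, b, c, d}"
    using moved ab cd by (auto simp: Transposition.transpose_def split: if_splits)
  have v: "v = (w \<circ> s) \<circ> u"
    using eq transposition_involution[OF T(3)] by (metis comp_assoc comp_id)
  show ?thesis
  proof (cases "s \<circ> w = w \<circ> s")
    case False
    \<comment> \<open>Here \<open>w \<circ> s\<close> is a 3-cycle on three points, so
      \<open>u\<close> is one of the three transpositions of these points.\<close>
    obtain a b c where *: "a \<noteq> b" "b \<noteq> c" "a \<noteq> c" "s = transpose a b" "w = transpose b c"
      using noncommuting_transpositionsE[OF T(1,2) False] by metis
    have "x \<in> {a, b, c}" "y \<in> {a, b, c}"
      using moved * by (auto simp: Transposition.transpose_def split: if_splits)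
    moreover have "s \<circ> w \<circ> s = transpose a c"
      using * transpose_comp_triple[of a c b] by simp
    ultimately show ?thesis using xy * by (auto simp: transpose_commute)
  next
    case True
    have "{a, b} \<inter> {c, d} = {}"
      using True transposes_commute_iff[of a b c d] \<open>s \<noteq> w\<close> ab cd
        transpose_eq_transpose_iff[of a b c d] by auto
    then have dist: "a \<noteq> c" "a \<noteq> d" "b \<noteq> c" "b \<noteq> d" by auto
    \<comment> \<open>A transposition \<open>u\<close> joining a point of \<open>s\<close> to a
      point of \<open>w\<close> is impossible: its cofactor \<open>v\<close> would send
      \<open>a'\<close> to \<open>d'\<close> and \<open>d'\<close> to \<open>c'\<close>, so it would
      not be an involution.\<close>
    have mixed: "u \<noteq> transpose a' c'"
      if "w = transpose c' d'" "s = transpose a' b'" "a' \<noteq> b'" "c' \<noteq> d'"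
        "a' \<noteq> c'" "a' \<noteq> d'" "b' \<noteq> c'" "b' \<noteq> d'" for a' b' c' d'
    proof
      assume u: "u = transpose a' c'"
      have "v a' = d'" using that unfolding v u by simp
      moreover have "v d' = c'" using that unfolding v u by simp
      moreover have "v (v a') = a'"
        using transposition_involution[OF T(4)] by (simp add: fun_eq_iff)
      ultimately show False using that by simp
    qed
    have "{x, y} = {a, b} \<or> {x, y} = {c, d}"
      using xm ym xy(1) mixed[of c d a b] mixed[of d c a b] mixed[of c d b a] mixed[of d c b a]
        dist ab cd xy(2) by (auto simp: transpose_commute)
    then show ?thesis using xy ab cd by (auto simp: doubleton_eq_iff transpose_commute)
  qed
qed

subsection \<open>Automorphisms of the transposition graph\<close>

text \<open>\<open>t\<close> is a total function on self-maps, but only its restriction to the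
  permutations of \<open>A\<close> is constrained.\<close>

definition transposition_graph_aut :: "'a set \<Rightarrow> (('a \<Rightarrow> 'a) \<Rightarrow> 'a \<Rightarrow> 'a) \<Rightarrow> bool" where
  "transposition_graph_aut A t \<longleftrightarrow>
     bij_betw t {p. p permutes A} {p. p permutes A} \<and>
     (\<forall>p q. p permutes A \<longrightarrow> q permutes A \<longrightarrow>
        (t p \<circ> inv' (t q) \<in> transpositions A \<longleftrightarrow> p \<circ> inv' q \<in> transpositions A))"

lemma transposition_graph_autI:
  assumes "\<And>p. p permutes A \<Longrightarrow> t p permutes A"
    and "\<And>p. p permutes A \<Longrightarrow> u p permutes A"
    and "\<And>p. p permutes A \<Longrightarrow> u (t p) = p"
    and "\<And>p. p permutes A \<Longrightarrow> t (u p) = p"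
    and "\<And>p q. p permutes A \<Longrightarrow> q permutes A \<Longrightarrow>
      t p \<circ> inv' (t q) \<in> transpositions A \<longleftrightarrow> p \<circ> inv' q \<in> transpositions A"
  shows "transposition_graph_aut A t"
  unfolding transposition_graph_aut_def
  using assms by (auto intro!: bij_betw_byWitness[where f' = u])

lemma transposition_graph_aut_permutes:
  "transposition_graph_aut A t \<Longrightarrow> p permutes A \<Longrightarrow> t p permutes A"
  unfolding transposition_graph_aut_def bij_betw_def by auto

lemma transposition_graph_aut_inj:
  assumes "transposition_graph_aut A t" "p permutes A" "q permutes A" "t p = t q"
  shows "p = q"
proof -
  have "inj_on t {p. p permutes A}"
    using assms(1) by (auto simp: transposition_graph_aut_def bij_betw_def)
  then show ?thesis using assms(2-4) by (auto dest: inj_onD)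
qed

lemma transposition_graph_aut_adjacent:
  "transposition_graph_aut A t \<Longrightarrow> p permutes A \<Longrightarrow> q permutes A \<Longrightarrow>
    p \<circ> inv' q \<in> transpositions A \<Longrightarrow> t p \<circ> inv' (t q) \<in> transpositions A"
  unfolding transposition_graph_aut_def by blast

lemma transposition_graph_aut_comp:
  assumes "transposition_graph_aut A t" "transposition_graph_aut A u"
  shows "transposition_graph_aut A (\<lambda>p. t (u p))"
  using assms bij_betw_trans[of u "{p. p permutes A}" "{p. p permutes A}" t]
    transposition_graph_aut_permutes[OF assms(2)]
  unfolding transposition_graph_aut_def by (auto simp: comp_def)

section \<open>Multiplications and inversion as graph automorphisms\<close>

lemma permutes_comp_inv_cancel:
  assumes "p permutes A"
  shows "p \<circ> (inv' p \<circ> f) = f" "inv' p \<circ> (p \<circ> f) = f"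
  using permutes_inverses[OF assms] by (auto simp: fun_eq_iff)

lemma permutes_inv_comp:
  assumes "p permutes A" "q permutes A"
  shows "inv' (p \<circ> q) = inv' q \<circ> inv' p"
  using permutes_bij[OF assms(1)] permutes_bij[OF assms(2)] by (rule o_inv_distrib)

lemma transpositions_conjugate_iff:
  assumes "p permutes A"
  shows "p \<circ> s \<circ> inv' p \<in> transpositions A \<longleftrightarrow> s \<in> transpositions A"
proof
  assume "p \<circ> s \<circ> inv' p \<in> transpositions A"
  from transpositions_conjugate[OF this permutes_inv[OF assms]]
  show "s \<in> transpositions A"
    by (simp add: comp_assoc permutes_comp_inv_cancel[OF assms] permutes_inv_o[OF assms]
        permutes_inv_inv[OF assms])
qed (rule transpositions_conjugate[OF _ assms])

text \<open>Left multiplication conjugates the quotient \<open>p \<circ> inv' q\<close> by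
  \<open>r\<close>, and conjugation preserves the set of transpositions.\<close>

lemma transposition_graph_aut_left:
  assumes r: "r permutes A"
  shows "transposition_graph_aut A (\<lambda>p. r \<circ> p)"
proof (rule transposition_graph_autI[where u = "\<lambda>p. inv' r \<circ> p"])
  fix p q :: "'a \<Rightarrow> 'a" assume pq: "p permutes A" "q permutes A"
  have "(r \<circ> p) \<circ> inv' (r \<circ> q) = r \<circ> (p \<circ> inv' q) \<circ> inv' r"
    by (simp only: permutes_inv_comp[OF r pq(2)] comp_assoc)
  then show "(r \<circ> p) \<circ> inv' (r \<circ> q) \<in> transpositions A \<longleftrightarrow> p \<circ> inv' q \<in> transpositions A"
    by (simp only: transpositions_conjugate_iff[OF r])
qed (use r in \<open>auto intro: permutes_compose permutes_inv simp: permutes_comp_inv_cancel[OF r]\<close>)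

text \<open>The factor \<open>r\<close> cancels in the quotient
  \<open>p \<circ> inv' q\<close>.\<close>

lemma transposition_graph_aut_right:
  assumes r: "r permutes A"
  shows "transposition_graph_aut A (\<lambda>p. p \<circ> r)"
proof (rule transposition_graph_autI[where u = "\<lambda>p. p \<circ> inv' r"])
  fix p q :: "'a \<Rightarrow> 'a" assume pq: "p permutes A" "q permutes A"
  have "(p \<circ> r) \<circ> inv' (q \<circ> r) = p \<circ> inv' q"
    by (simp only: permutes_inv_comp[OF pq(2) r] comp_assoc permutes_comp_inv_cancel[OF r])
  then show "(p \<circ> r) \<circ> inv' (q \<circ> r) \<in> transpositions A \<longleftrightarrow> p \<circ> inv' q \<in> transpositions A"
    by simp
qed (use r in \<open>auto intro: permutes_compose permutes_inv simp: comp_assoc permutes_inv_o[OF r]\<close>)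

lemma transpositions_inv_iff:
  assumes "p permutes A"
  shows "inv' p \<in> transpositions A \<longleftrightarrow> p \<in> transpositions A"
  using transposition_inv permutes_inv_inv[OF assms] by metis

text \<open>Conjugation by \<open>p\<close> turns \<open>inv' p \<circ> q\<close> into the inverse
  of \<open>p \<circ> inv' q\<close>. This is what makes inversion a graph automorphism.\<close>

lemma adjacent_left_iff_right:
  assumes p: "p permutes A" and q: "q permutes A"
  shows "inv' p \<circ> q \<in> transpositions A \<longleftrightarrow> p \<circ> inv' q \<in> transpositions A"
proof -
  have "inv' p \<circ> q \<in> transpositions A \<longleftrightarrow> p \<circ> (inv' p \<circ> q) \<circ> inv' p \<in> transpositions A"
    by (simp only: transpositions_conjugate_iff[OF p])
  also have "p \<circ> (inv' p \<circ> q) \<circ> inv' p = inv' (p \<circ> inv' q)"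
    by (simp add: permutes_comp_inv_cancel[OF p] permutes_inv_comp[OF p permutes_inv[OF q]]
        permutes_inv_inv[OF q])
  also have "\<dots> \<in> transpositions A \<longleftrightarrow> p \<circ> inv' q \<in> transpositions A"
    by (rule transpositions_inv_iff) (intro permutes_compose permutes_inv p q)
  finally show ?thesis .
qed

lemma transposition_graph_aut_inv: "transposition_graph_aut A (\<lambda>p. inv' p)"
proof (rule transposition_graph_autI[where u = "\<lambda>p. inv' p"])
  fix p q :: "'a \<Rightarrow> 'a" assume pq: "p permutes A" "q permutes A"
  then show "inv' p \<circ> inv' (inv' q) \<in> transpositions A \<longleftrightarrow> p \<circ> inv' q \<in> transpositions A"
    by (simp add: permutes_inv_inv adjacent_left_iff_right)
qed (auto intro: permutes_inv simp: permutes_inv_inv)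

section \<open>Automorphisms fixing the identity: action on transpositions\<close>

lemma aut_transposition:
  assumes t: "transposition_graph_aut A t" "t id = id" and s: "s \<in> transpositions A"
  shows "t s \<in> transpositions A"
  using transposition_graph_aut_adjacent[OF t(1) transposition_permutes[OF s] permutes_id] s t(2)
  by simp

text \<open>Adjacency gives transpositions \<open>u\<close>, \<open>v\<close> with
  \<open>t (s \<circ> w) = v \<circ> t w = u \<circ> t s\<close>. Hence
  \<open>u \<circ> v = t s \<circ> t w\<close>, and \<open>factorisations_of_product\<close> leaves
  three values for \<open>v\<close>.\<close>

lemma aut_product:
  assumes t: "transposition_graph_aut A t" "t id = id"
    and s: "s \<in> transpositions A" and w: "w \<in> transpositions A"
  shows "t (s \<circ> w) = t s \<circ> t w \<or> t (s \<circ> w) = t w \<circ> t s"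
proof (cases "s = w")
  case True
  then show ?thesis
    using transposition_involution[OF s] transposition_involution[OF aut_transposition[OF t s]] t(2)
    by simp
next
  case False
  note sp = transposition_permutes[OF s] and wp = transposition_permutes[OF w]
  note swp = permutes_compose[OF wp sp]
  note ts = aut_transposition[OF t s] and tw = aut_transposition[OF t w]
  define v where "v = t (s \<circ> w) \<circ> inv' (t w)"
  define u where "u = t (s \<circ> w) \<circ> inv' (t s)"
  have "(s \<circ> w) \<circ> inv' w \<in> transpositions A"
    using s by (simp add: comp_assoc permutes_inv_o[OF wp])
  then have v: "v \<in> transpositions A"
    unfolding v_def by (rule transposition_graph_aut_adjacent[OF t(1) swp wp])
  have "(s \<circ> w) \<circ> inv' s \<in> transpositions A"
    by (rule transpositions_conjugate[OF w sp])
  then have u: "u \<in> transpositions A"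
    unfolding u_def by (rule transposition_graph_aut_adjacent[OF t(1) swp sp])
  have vw: "t (s \<circ> w) = v \<circ> t w" and us: "t (s \<circ> w) = u \<circ> t s"
    unfolding v_def u_def
    using permutes_inv_o(2)[OF transposition_permutes[OF tw]]
      permutes_inv_o(2)[OF transposition_permutes[OF ts]]
    by (simp_all add: comp_assoc)
  have "u \<circ> v \<circ> t w = t s"
    using transposition_cancel_left[OF u, of "t s"] vw us by (simp only: comp_assoc)
  then have uv: "u \<circ> v = t s \<circ> t w"
    using transposition_involution[OF tw] by (metis comp_assoc comp_id)
  have ne: "t w \<noteq> t s" using transposition_graph_aut_inj[OF t(1) wp sp] False by auto
  \<comment> \<open>The value \<open>t w\<close> would give \<open>t (s \<circ> w) = id\<close>; the
    other two values give the two claimed products.\<close>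
  have "v \<in> {t w, t s, t w \<circ> t s \<circ> t w}"
    using factorisations_of_product[of "t w" "t s" v u] uv ne ts tw u v
    by (blast intro: transpositions_mono)
  moreover have "v \<noteq> t w"
  proof
    assume "v = t w"
    then have "t (s \<circ> w) = t id" using vw transposition_involution[OF tw] t(2) by simp
    then have "s \<circ> w = id" using transposition_graph_aut_inj[OF t(1) swp permutes_id] by simp
    then show False using transposition_cancel_left[OF s, of w] False by simp
  qed
  moreover have "t w \<circ> t s \<circ> t w \<circ> t w = t w \<circ> t s"
    using transposition_involution[OF tw] by (simp add: comp_assoc)
  ultimately show ?thesis using vw by (metis insertE singletonD)
qed

text \<open>If the images commuted, \<open>s \<circ> w\<close> and \<open>w \<circ> s\<close> would
  both be sent to \<open>t s \<circ> t w\<close>, against injectivity.\<close>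

lemma aut_noncommuting:
  assumes t: "transposition_graph_aut A t" "t id = id"
    and s: "s \<in> transpositions A" and w: "w \<in> transpositions A" and ne: "s \<circ> w \<noteq> w \<circ> s"
  shows "t s \<circ> t w \<noteq> t w \<circ> t s"
proof
  assume "t s \<circ> t w = t w \<circ> t s"
  then have "t (s \<circ> w) = t (w \<circ> s)"
    using aut_product[OF t s w] aut_product[OF t w s] by metis
  then show False
    using transposition_graph_aut_inj[OF t(1)] ne
      permutes_compose[OF transposition_permutes[OF w] transposition_permutes[OF s]]
      permutes_compose[OF transposition_permutes[OF s] transposition_permutes[OF w]]
    by blast
qed

text \<open>Besides \<open>s\<close> and \<open>w\<close>, the transposition \<open>s w s\<close> is the only common neighbour of the
  identity and the two 3-cycles \<open>s w\<close> and \<open>w s\<close>.\<close>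

lemma aut_triangle:
  assumes t: "transposition_graph_aut A t" "t id = id"
    and s: "s \<in> transpositions A" and w: "w \<in> transpositions A" and ne: "s \<circ> w \<noteq> w \<circ> s"
  shows "t (s \<circ> w \<circ> s) = t s \<circ> t w \<circ> t s"
proof -
  note sp = transposition_permutes[OF s] and wp = transposition_permutes[OF w]
  note swp = permutes_compose[OF wp sp]
  note ts = aut_transposition[OF t s] and tw = aut_transposition[OF t w]
  have r0: "s \<circ> w \<circ> s \<in> transpositions A"
    using transpositions_conjugate[OF w sp] transposition_inv[OF s] by simp
  note rp = transposition_permutes[OF r0]
  define r where "r = t (s \<circ> w \<circ> s)"
  have r: "r \<in> transpositions A" unfolding r_def by (rule aut_transposition[OF t r0])
  \<comment> \<open>This quotient is \<open>s\<close> conjugated by \<open>s \<circ> w\<close>, so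
    \<open>r\<close> is adjacent to \<open>t (s \<circ> w)\<close>.\<close>
  have "(s \<circ> w \<circ> s) \<circ> inv' (s \<circ> w) \<in> transpositions A"
    by (rule transpositions_conjugate[OF s swp])
  moreover define v where "v = r \<circ> inv' (t (s \<circ> w))"
  ultimately have v: "v \<in> transpositions A"
    unfolding v_def r_def by (metis transposition_graph_aut_adjacent[OF t(1) rp swp])
  note tswp = transposition_graph_aut_permutes[OF t(1) swp]
  have "v \<circ> t (s \<circ> w) = r"
    unfolding v_def using permutes_inv_o(2)[OF tswp] by (simp add: comp_assoc)
  then have vr: "v \<circ> r = t (s \<circ> w)"
    using transposition_cancel_left[OF v] by metis
  have neq: "t s \<noteq> t w" using aut_noncommuting[OF t s w ne] by auto
  note U = transpositions_mono
  have "t (s \<circ> w) = t s \<circ> t w \<or> t (s \<circ> w) = t w \<circ> t s"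
    by (rule aut_product[OF t s w])
  \<comment> \<open>Since \<open>r\<close> is the right factor in
    \<open>v \<circ> r = t (s \<circ> w)\<close>, \<open>factorisations_of_product\<close> applies
    to either order of the product \<open>t (s \<circ> w)\<close>.\<close>
  then have "r \<in> {t w, t s, t w \<circ> t s \<circ> t w} \<or> r \<in> {t s, t w, t s \<circ> t w \<circ> t s}"
    using factorisations_of_product[OF U[OF tw] U[OF ts] U[OF r] U[OF v] neq[symmetric]]
      factorisations_of_product[OF U[OF ts] U[OF tw] U[OF r] U[OF v] neq] vr
    by metis
  moreover have "r \<noteq> t s"
  proof
    assume "r = t s"
    then have "s \<circ> (w \<circ> s) = s"
      using transposition_graph_aut_inj[OF t(1) rp sp] r_def by (simp add: comp_assoc)
    then have "w \<circ> s = id"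
      using transposition_cancel_left[OF s, of "w \<circ> s"] transposition_involution[OF s] by simp
    then show False using ne transposition_cancel_left[OF w, of s] by auto
  qed
  moreover have "r \<noteq> t w"
  proof
    assume "r = t w"
    then have "s \<circ> (w \<circ> s) = w"
      using transposition_graph_aut_inj[OF t(1) rp wp] r_def by (simp add: comp_assoc)
    then show False
      using transposition_cancel_left[OF s, of "w \<circ> s"] ne by auto
  qed
  \<comment> \<open>The two orders lead to the same third transposition, so it does not matter which
    of them occurred.\<close>
  moreover have "t s \<circ> t w \<circ> t s = t w \<circ> t s \<circ> t w"
    by (rule braid_transpositions[OF ts tw aut_noncommuting[OF t s w ne]])
  ultimately show ?thesis unfolding r_def by auto
qed

text \<open>The star of transpositions at a point \<open>a\<close> is mapped to the star at some point \<open>p\<close>: the images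
  pairwise meet, and by \<open>aut_triangle\<close> three of them cannot form a triangle.\<close>

lemma aut_permutes_points:
  assumes t: "transposition_graph_aut A t" "t id = id"
    and fin: "finite A" and card: "card A \<ge> 3"
  obtains \<pi> where "\<pi> permutes A"
    "\<And>i j. i \<in> A \<Longrightarrow> j \<in> A \<Longrightarrow> i \<noteq> j \<Longrightarrow> t (transpose i j) = transpose (\<pi> i) (\<pi> j)"
proof -
  obtain B where "B \<subseteq> A" "card B = 3"
    using obtain_subset_with_card_n[OF card] by metis
  then obtain a b c where abc: "a \<in> A" "b \<in> A" "c \<in> A" "a \<noteq> b" "b \<noteq> c" "a \<noteq> c"
    by (auto simp: card_3_iff)
  have tT: "t (transpose i j) \<in> transpositions A" if "i \<in> A" "j \<in> A" "i \<noteq> j" for i j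
    using that by (intro aut_transposition[OF t] transpositionsI)
  have meet: "t (transpose a i) \<circ> t (transpose a j) \<noteq> t (transpose a j) \<circ> t (transpose a i)"
    if "i \<in> A" "j \<in> A" "i \<noteq> a" "j \<noteq> a" "i \<noteq> j" for i j
  proof (rule aut_noncommuting[OF t])
    show "transpose a i \<circ> transpose a j \<noteq> transpose a j \<circ> transpose a i"
      using that transposes_commute_iff[of a i a j] by (auto simp: doubleton_eq_iff)
  qed (use that abc in \<open>auto intro: transpositionsI\<close>)
  have third: "t (transpose i j) =
      t (transpose a i) \<circ> t (transpose a j) \<circ> t (transpose a i)"
    if "i \<in> A" "j \<in> A" "i \<noteq> a" "j \<noteq> a" "i \<noteq> j" for i j
  proof -
    have "t (transpose a i \<circ> transpose a j \<circ> transpose a i) =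
        t (transpose a i) \<circ> t (transpose a j) \<circ> t (transpose a i)"
    proof (rule aut_triangle[OF t])
      show "transpose a i \<circ> transpose a j \<noteq> transpose a j \<circ> transpose a i"
        using that transposes_commute_iff[of a i a j] by (auto simp: doubleton_eq_iff)
    qed (use that abc in \<open>auto intro: transpositionsI\<close>)
    then show ?thesis
      using transpose_comp_triple[of i j a] that by (simp add: transpose_commute)
  qed
  \<comment> \<open>The images of the edges from \<open>a\<close> to \<open>b\<close> and from
    \<open>a\<close> to \<open>c\<close> share exactly one point; this point \<open>p\<close> will
    be the image of \<open>a\<close>.\<close>
  obtain q p r where qpr: "p \<in> A" "q \<in> A" "r \<in> A" "q \<noteq> p" "p \<noteq> r" "q \<noteq> r"
    and tb: "t (transpose a b) = transpose q p" and tc: "t (transpose a c) = transpose p r"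
    using noncommuting_transpositionsE[OF tT tT meet[of b c]] abc by metis
  have tbc: "t (transpose b c) = transpose q r"
    using third[of b c] transpose_comp_triple[of q r p] abc qpr tb tc by simp
  have "\<exists>j. j \<in> A \<and> j \<noteq> p \<and> t (transpose a i) = transpose p j" if i: "i \<in> A" "i \<noteq> a" for i
  proof -
    consider "i = b" | "i = c" | "i \<noteq> b" "i \<noteq> c" by blast
    then show ?thesis
    proof cases
      case 1
      then show ?thesis using tb qpr by (auto simp: transpose_commute)
    next
      case 2
      then show ?thesis using tc qpr by auto
    next
      case 3
      obtain x y where xy: "x \<in> A" "y \<in> A" "x \<noteq> y" "t (transpose a i) = transpose x y"
        using tT[of a i] i abc by (auto elim!: transpositionsE)
      \<comment> \<open>An edge meeting both \<open>{q, p}\<close> and \<open>{p, r}\<close>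
        contains \<open>p\<close> or equals \<open>{q, r}\<close>. The second is already the image
        of \<open>transpose b c\<close>, so injectivity excludes it.\<close>
      have "{x, y} \<inter> {q, p} \<noteq> {}" "{x, y} \<inter> {p, r} \<noteq> {}"
        using meet[of i b] meet[of i c] abc 3 i xy tb tc
          transposes_commute_iff[of x y q p] transposes_commute_iff[of x y p r] qpr by auto
      moreover have "{x, y} \<noteq> {q, r}"
      proof
        assume "{x, y} = {q, r}"
        then have "t (transpose a i) = t (transpose b c)"
          using xy tbc transpose_eq_transpose_iff[of x y q r] by simp
        then have "transpose a i = transpose b c"
          using transposition_graph_aut_inj[OF t(1)] i abc by (blast intro: permutes_swap_id)
        then show False
          using transpose_eq_transpose_iff[of a i b c] i abc by (auto simp: doubleton_eq_iff)
      qed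
      ultimately have "x = p \<or> y = p" using qpr by auto
      then show ?thesis using xy by (auto simp: transpose_commute)
    qed
  qed
  then obtain f where f: "\<And>i. i \<in> A \<Longrightarrow> i \<noteq> a \<Longrightarrow> f i \<in> A \<and> f i \<noteq> p \<and> t (transpose a i) = transpose p (f i)"
    by metis
  \<comment> \<open>The centre \<open>a\<close> of the star goes to \<open>p\<close>, and every
    other end to the free end of the image edge. Outside \<open>A\<close> the map is the identity,
    as \<open>permutes\<close> demands.\<close>
  define \<pi> where "\<pi> i = (if i = a then p else if i \<in> A then f i else i)" for i
  have "i = j" if ij: "i \<in> A" "j \<in> A" "i \<noteq> a" "j \<noteq> a" "f i = f j" for i j
  proof -
    have "t (transpose a i) = t (transpose a j)" using f[of i] f[of j] ij by simp
    then have "transpose a i = transpose a j"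
      using transposition_graph_aut_inj[OF t(1)] ij abc by (blast intro: permutes_swap_id)
    then show ?thesis
      using transpose_eq_transpose_iff[of a i a j] ij by (auto simp: doubleton_eq_iff)
  qed
  then have inj: "inj_on \<pi> A"
    using f unfolding \<pi>_def inj_on_def by metis
  moreover have "\<pi> ` A \<subseteq> A" using f qpr by (auto simp: \<pi>_def)
  ultimately have "bij_betw \<pi> A A"
    using endo_inj_surj[OF fin] by (auto simp: bij_betw_def)
  then have "\<pi> permutes A"
    by (rule bij_imp_permutes) (use abc in \<open>auto simp: \<pi>_def\<close>)
  moreover have "t (transpose i j) = transpose (\<pi> i) (\<pi> j)" if ij: "i \<in> A" "j \<in> A" "i \<noteq> j" for i j
  proof -
    consider "i = a" | "j = a" | "i \<noteq> a" "j \<noteq> a" by blast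
    then show ?thesis
    proof cases
      case 1
      then show ?thesis using f[of j] ij by (simp add: \<pi>_def)
    next
      case 2
      then show ?thesis using f[of i] ij by (simp add: \<pi>_def transpose_commute)
    next
      case 3
      \<comment> \<open>An edge that avoids \<open>a\<close> is one star edge conjugated by another;
        \<open>third\<close> carries this relation over to the images.\<close>
      have "f i \<noteq> f j" using inj ij 3 by (auto simp: \<pi>_def inj_on_def)
      then have "transpose p (f i) \<circ> transpose p (f j) \<circ> transpose p (f i) = transpose (f i) (f j)"
        using transpose_comp_triple[of "f i" "f j" p] f[of j] ij 3
        by (auto simp: transpose_commute[of p "f i"])
      then show ?thesis
        using third[of i j] f[of i] f[of j] ij 3 by (simp add: \<pi>_def)
    qed
  qed
  ultimately show thesis by (rule that)
qed

section \<open>Automorphisms fixing every transposition\<close>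

lemma transposition_graph_aut_twist:
  assumes "transposition_graph_aut A t" "s permutes A"
  shows "transposition_graph_aut A (\<lambda>x. s \<circ> t (s \<circ> x))"
proof -
  note left = transposition_graph_aut_left[OF assms(2)]
  show ?thesis
    using transposition_graph_aut_comp[OF left transposition_graph_aut_comp[OF assms(1) left]] .
qed

text \<open>The point permutation of the twist \<open>u\<close> preserves the two points moved by
  \<open>s\<close>, because \<open>u s = s\<close>, and it fixes every other point. So it is the
  identity or agrees with \<open>s\<close>, and each possibility gives one alternative.\<close>

lemma aut_products_dichotomy:
  assumes t: "transposition_graph_aut A t" "t id = id"
    and fin: "finite A" and card: "card A \<ge> 3"
    and fix1: "\<And>w. w \<in> transpositions A \<Longrightarrow> t w = w"
    and s: "s \<in> transpositions A"
  shows "(\<forall>w\<in>transpositions A. t (s \<circ> w) = s \<circ> w) \<or> (\<forall>w\<in>transpositions A. t (s \<circ> w) = w \<circ> s)"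
proof -
  note sp = transposition_permutes[OF s]
  \<comment> \<open>The twist moves the base point from \<open>id\<close> to \<open>s\<close>: the
    values of \<open>t\<close> at the neighbours \<open>s \<circ> w\<close> of \<open>s\<close>
    become values of \<open>u\<close> at transpositions.\<close>
  define u where "u x = s \<circ> t (s \<circ> x)" for x
  have u: "transposition_graph_aut A u" "u id = id"
  proof -
    show "transposition_graph_aut A u"
      unfolding u_def by (rule transposition_graph_aut_twist[OF t(1) sp])
    show "u id = id"
      unfolding u_def using fix1[OF s] transposition_involution[OF s] by simp
  qed
  have tu: "t (s \<circ> x) = s \<circ> u x" for x
    unfolding u_def by (simp add: transposition_cancel_left[OF s])
  obtain \<pi> where \<pi>: "\<pi> permutes A"
    and u\<pi>: "\<And>i j. i \<in> A \<Longrightarrow> j \<in> A \<Longrightarrow> i \<noteq> j \<Longrightarrow> u (transpose i j) = transpose (\<pi> i) (\<pi> j)"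
    using aut_permutes_points[OF u fin card] by metis
  have inj: "\<pi> i = \<pi> j \<longleftrightarrow> i = j" for i j
    using permutes_inj[OF \<pi>] by (auto simp: inj_eq)
  obtain a b where ab: "a \<in> A" "b \<in> A" "a \<noteq> b" "s = transpose a b" using s by (rule transpositionsE)
  have "u s = s"
    unfolding u_def using transposition_involution[OF s] t(2) by simp
  then have \<pi>ab: "{\<pi> a, \<pi> b} = {a, b}"
    using u\<pi>[of a b] ab transpose_eq_transpose_iff[of "\<pi> a" "\<pi> b" a b] inj[of a b] by simp
  \<comment> \<open>By \<open>aut_product\<close>, \<open>u\<close> sends
    \<open>transpose b c\<close> to itself or to \<open>transpose a c\<close>. In both cases
    \<open>c\<close> is among the images of \<open>b\<close> and \<open>c\<close>, and
    \<open>\<pi> b\<close> lies in \<open>{a, b}\<close>.\<close>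
  have fixc: "\<pi> c = c" if c: "c \<in> A" "c \<noteq> a" "c \<noteq> b" for c
  proof -
    have w: "transpose b c \<in> transpositions A" using c ab by (auto intro: transpositionsI)
    have "t (s \<circ> transpose b c) = s \<circ> transpose b c \<or> t (s \<circ> transpose b c) = transpose b c \<circ> s"
      using aut_product[OF t s w] unfolding fix1[OF s] fix1[OF w] .
    then have "u (transpose b c) = transpose b c \<or> u (transpose b c) = s \<circ> transpose b c \<circ> s"
      unfolding u_def using transposition_cancel_left[OF s] by (metis comp_assoc)
    moreover have "s \<circ> transpose b c \<circ> s = transpose a c"
      using transpose_comp_triple[of a c b] c ab by simp
    ultimately have "{\<pi> b, \<pi> c} = {b, c} \<or> {\<pi> b, \<pi> c} = {a, c}"
      using u\<pi>[of b c] transpose_eq_transpose_iff[of "\<pi> b" "\<pi> c"] c ab inj[of b c] by auto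
    then show ?thesis using \<pi>ab c by (auto simp: doubleton_eq_iff)
  qed
  have "\<pi> a = a \<and> \<pi> b = b \<or> \<pi> a = b \<and> \<pi> b = a"
    using \<pi>ab by (auto simp: doubleton_eq_iff)
  then show ?thesis
  proof
    assume id: "\<pi> a = a \<and> \<pi> b = b"
    then have "\<pi> i = i" if "i \<in> A" for i using fixc that by blast
    then have "u w = w" if "w \<in> transpositions A" for w
      using that u\<pi> by (auto elim!: transpositionsE)
    then show ?thesis using tu by simp
  next
    assume swap: "\<pi> a = b \<and> \<pi> b = a"
    then have \<pi>s: "\<pi> i = s i" if "i \<in> A" for i
      using fixc that unfolding ab(4) by (cases "i = a"; cases "i = b") auto
    \<comment> \<open>Acting on points as \<open>s\<close> means conjugating transpositions by
      \<open>s\<close>; then \<open>t (s \<circ> w) = s \<circ> u w\<close> collapses to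
      \<open>w \<circ> s\<close>.\<close>
    have "u w = s \<circ> (w \<circ> s)" if "w \<in> transpositions A" for w
    proof -
      obtain i j where w: "i \<in> A" "j \<in> A" "i \<noteq> j" "w = transpose i j"
        using \<open>w \<in> transpositions A\<close> by (rule transpositionsE)
      have "s \<circ> w \<circ> s = transpose (s i) (s j)"
        using transpose_conjugate[OF sp, of i j] transposition_inv[OF s] w(4) by simp
      then show ?thesis using u\<pi>[OF w(1-3)] \<pi>s w by (simp add: comp_assoc)
    qed
    then show ?thesis by (simp add: tu transposition_cancel_left[OF s])
  qed
qed

text \<open>A single non-commuting pair selects the alternative at \<open>s\<^sub>0\<close>, and the
  choice spreads to every transposition through non-commuting pairs.\<close>

lemma aut_fixes_products:
  assumes t: "transposition_graph_aut A t" "t id = id"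
    and fin: "finite A" and card: "card A \<ge> 3"
    and fix1: "\<And>w. w \<in> transpositions A \<Longrightarrow> t w = w"
    and s0: "s\<^sub>0 \<in> transpositions A" and w0: "w\<^sub>0 \<in> transpositions A"
    and ne0: "s\<^sub>0 \<circ> w\<^sub>0 \<noteq> w\<^sub>0 \<circ> s\<^sub>0" and fix0: "t (s\<^sub>0 \<circ> w\<^sub>0) = s\<^sub>0 \<circ> w\<^sub>0"
    and s: "s \<in> transpositions A" and w: "w \<in> transpositions A"
  shows "t (s \<circ> w) = s \<circ> w"
proof -
  let ?T = "transpositions A"
  define F where "F s \<longleftrightarrow> (\<forall>w\<in>?T. t (s \<circ> w) = s \<circ> w)" for s
  have dichotomy: "F s \<or> (\<forall>w\<in>?T. t (s \<circ> w) = w \<circ> s)" if "s \<in> ?T" for s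
    unfolding F_def by (rule aut_products_dichotomy[OF t fin card fix1 that])
  have F0: "F s\<^sub>0"
    using dichotomy[OF s0] fix0 ne0 w0 by metis
  \<comment> \<open>With opposite alternatives at \<open>s\<close> and \<open>w\<close>, both
    \<open>s \<circ> w\<close> and \<open>w \<circ> s\<close> would be sent to
    \<open>s \<circ> w\<close>.\<close>
  have step: "F w" if "F s" and s: "s \<in> ?T" and w: "w \<in> ?T" and ne: "s \<circ> w \<noteq> w \<circ> s" for s w
  proof (rule ccontr)
    assume "\<not> F w"
    then have "t (w \<circ> s) = s \<circ> w" using dichotomy[OF w] s by blast
    moreover have "t (s \<circ> w) = s \<circ> w" using \<open>F s\<close> w unfolding F_def by blast
    ultimately have "t (w \<circ> s) = t (s \<circ> w)" by simp
    then have "w \<circ> s = s \<circ> w"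
      by (rule transposition_graph_aut_inj[OF t(1), rotated 2])
        (intro permutes_compose transposition_permutes s w)+
    then show False using ne by simp
  qed
  have "F s"
  proof (cases "s\<^sub>0 = s \<or> s\<^sub>0 \<circ> s \<noteq> s \<circ> s\<^sub>0")
    case True
    then show ?thesis using F0 step[OF F0 s0 s] by blast
  next
    case False
    obtain a b where ab: "a \<in> A" "b \<in> A" "a \<noteq> b" "s\<^sub>0 = transpose a b" using s0 by (rule transpositionsE)
    obtain c d where cd: "c \<in> A" "d \<in> A" "c \<noteq> d" "s = transpose c d" using s by (rule transpositionsE)
    have disj: "{a, b} \<inter> {c, d} = {}"
      using False ab cd transposes_commute_iff[of a b c d] transpose_eq_transpose_iff[of a b c d] by auto
    \<comment> \<open>Disjoint transpositions are linked through one that shares exactly one point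
      with each of them.\<close>
    have m: "transpose b c \<in> ?T" using disj ab cd by (auto intro: transpositionsI)
    have "F (transpose b c)"
      using step[OF F0 s0 m] noncommuting_transposesI[of a b c] disj ab cd by auto
    then show ?thesis
      using step[OF _ m s] noncommuting_transposesI[of b c d] disj ab cd by auto
  qed
  then show ?thesis using w unfolding F_def by blast
qed

text \<open>Each induction step strips a transposition \<open>s\<close> from the left of the
  permutation and replaces \<open>t\<close> by its twist at \<open>s\<close>. Hence \<open>t\<close>
  is generalised, and its hypotheses are re-established for the twist.\<close>

lemma aut_fixing_products_trivial:
  assumes fin: "finite A" and card: "card A \<ge> 3" and p: "p permutes A"
  shows "transposition_graph_aut A t \<Longrightarrow> t id = id \<Longrightarrow> (\<And>w. w \<in> transpositions A \<Longrightarrow> t w = w) \<Longrightarrow>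
    (\<And>s w. s \<in> transpositions A \<Longrightarrow> w \<in> transpositions A \<Longrightarrow> t (s \<circ> w) = s \<circ> w) \<Longrightarrow> t p = p"
  using p fin
proof (induction p arbitrary: t rule: permutes_induct)
  case id
  then show ?case by simp
next
  case (swap a b p)
  note t = swap.prems(1,2) and fix1 = swap.prems(3) and fix2 = swap.prems(4)
  define s where "s = transpose a b"
  have s: "s \<in> transpositions A" unfolding s_def using swap by (intro transpositionsI)
  note sp = transposition_permutes[OF s]
  \<comment> \<open>A third point supplies a \<open>w\<close> that does not commute with
    \<open>s\<close>. The twist fixes \<open>s \<circ> w\<close> because \<open>t\<close> fixes
    \<open>w\<close>, so \<open>aut_fixes_products\<close> applies to the twist.\<close>
  have "\<not> A \<subseteq> {a, b}" using card card_mono[of "{a, b}" A] swap.hyps(3) by auto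
  then obtain c where c: "c \<in> A" "c \<noteq> a" "c \<noteq> b" by auto
  define w where "w = transpose b c"
  have w: "w \<in> transpositions A" unfolding w_def using swap c by (intro transpositionsI) auto
  have ne: "s \<circ> w \<noteq> w \<circ> s"
    unfolding s_def w_def using swap c by (intro noncommuting_transposesI) auto
  define u where "u x = s \<circ> t (s \<circ> x)" for x
  have u1: "transposition_graph_aut A u"
    unfolding u_def by (rule transposition_graph_aut_twist[OF t(1) sp])
  have u2: "u id = id"
    unfolding u_def using fix1[OF s] transposition_involution[OF s] by simp
  have u3: "u v = v" if "v \<in> transpositions A" for v
    unfolding u_def by (simp only: fix2[OF s that] transposition_cancel_left[OF s])
  have usw: "u (s \<circ> w) = s \<circ> w"
    unfolding u_def by (simp only: fix1[OF w] transposition_cancel_left[OF s])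
  have u4: "u (x \<circ> y) = x \<circ> y" if "x \<in> transpositions A" "y \<in> transpositions A" for x y
    by (rule aut_fixes_products[OF u1 u2 fin card u3 s w ne usw that])
  have "u p = p" by (rule swap.IH[OF u1 u2 u3 u4])
  then show ?case
    unfolding u_def s_def[symmetric] using transposition_cancel_left[OF s] by metis
qed

text \<open>A left translation makes \<open>t\<close> fix \<open>id\<close>, and a conjugation then
  makes it fix every transposition. Undoing both yields the parameters
  \<open>g \<circ> \<pi>\<close> and \<open>\<pi>\<close>.\<close>

theorem transposition_graph_aut_cases:
  assumes t: "transposition_graph_aut A t" and fin: "finite A" and card: "card A \<ge> 3"
  obtains p q where "p permutes A" "q permutes A"
    "(\<forall>x. x permutes A \<longrightarrow> t x = p \<circ> x \<circ> inv' q) \<or> (\<forall>x. x permutes A \<longrightarrow> t x = p \<circ> inv' x \<circ> inv' q)"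
proof -
  define g where "g = t id"
  have g: "g permutes A"
    unfolding g_def by (rule transposition_graph_aut_permutes[OF t permutes_id])
  define t1 where "t1 x = inv' g \<circ> t x" for x
  have t1: "transposition_graph_aut A t1"
    unfolding t1_def
    by (rule transposition_graph_aut_comp[OF transposition_graph_aut_left[OF permutes_inv[OF g]] t])
  have t1id: "t1 id = id"
    unfolding t1_def g_def[symmetric] by (rule permutes_inv_o(2)[OF g])
  obtain \<pi> where \<pi>: "\<pi> permutes A"
    and t1\<pi>: "\<And>i j. i \<in> A \<Longrightarrow> j \<in> A \<Longrightarrow> i \<noteq> j \<Longrightarrow> t1 (transpose i j) = transpose (\<pi> i) (\<pi> j)"
    using aut_permutes_points[OF t1 t1id fin card] by metis
  define t2 where "t2 x = inv' \<pi> \<circ> t1 x \<circ> \<pi>" for x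
  have t2: "transposition_graph_aut A t2"
    unfolding t2_def
    by (rule transposition_graph_aut_comp[where t = "\<lambda>x. x \<circ> \<pi>", OF transposition_graph_aut_right[OF \<pi>]
          transposition_graph_aut_comp[OF transposition_graph_aut_left[OF permutes_inv[OF \<pi>]] t1]])
  have t2id: "t2 id = id"
    unfolding t2_def t1id using permutes_inv_o(2)[OF \<pi>] by simp
  have t2fix: "t2 w = w" if w: "w \<in> transpositions A" for w
  proof -
    obtain i j where "i \<in> A" "j \<in> A" "i \<noteq> j" "w = transpose i j"
      using w by (rule transpositionsE)
    then have "t1 w = \<pi> \<circ> w \<circ> inv' \<pi>" using t1\<pi> transpose_conjugate[OF \<pi>] by simp
    then show ?thesis
      unfolding t2_def
      by (simp add: comp_assoc permutes_comp_inv_cancel[OF \<pi>] permutes_inv_o[OF \<pi>])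
  qed
  have t_eq: "t x = (g \<circ> \<pi>) \<circ> t2 x \<circ> inv' \<pi>" for x
    unfolding t2_def t1_def
    by (simp add: comp_assoc permutes_comp_inv_cancel[OF \<pi>] permutes_comp_inv_cancel[OF g]
        permutes_inv_o[OF \<pi>])
  have g\<pi>: "g \<circ> \<pi> permutes A" by (rule permutes_compose[OF \<pi> g])
  obtain B where "B \<subseteq> A" "card B = 3"
    using obtain_subset_with_card_n[OF card] by metis
  then obtain a b c where abc: "a \<in> A" "b \<in> A" "c \<in> A" "a \<noteq> b" "b \<noteq> c" "a \<noteq> c"
    by (auto simp: card_3_iff)
  define s w where "s = transpose a b" and "w = transpose b c"
  have s: "s \<in> transpositions A" and w: "w \<in> transpositions A"
    unfolding s_def w_def using abc by (auto intro: transpositionsI)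
  have ne: "s \<circ> w \<noteq> w \<circ> s"
    unfolding s_def w_def using abc by (intro noncommuting_transposesI)
  \<comment> \<open>The value at one non-commuting pair decides whether \<open>t2\<close> is the
    identity or inversion.\<close>
  have "t2 (s \<circ> w) = s \<circ> w \<or> t2 (s \<circ> w) = w \<circ> s"
    using aut_product[OF t2 t2id s w] unfolding t2fix[OF s] t2fix[OF w] .
  then show thesis
  proof
    assume fixed: "t2 (s \<circ> w) = s \<circ> w"
    have "t2 x = x" if "x permutes A" for x
      by (rule aut_fixing_products_trivial[OF fin card that t2 t2id t2fix
            aut_fixes_products[OF t2 t2id fin card t2fix s w ne fixed]])
    then show thesis using that[OF g\<pi> \<pi>] t_eq by metis
  next
    assume rev: "t2 (s \<circ> w) = w \<circ> s"
    \<comment> \<open>Inversion reverses products of two transpositions and fixes each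
      transposition, so \<open>t3\<close> falls under the first case.\<close>
    define t3 where "t3 x = inv' (t2 x)" for x
    have t3: "transposition_graph_aut A t3"
      unfolding t3_def by (rule transposition_graph_aut_comp[OF transposition_graph_aut_inv t2])
    have t3id: "t3 id = id" unfolding t3_def t2id by simp
    have t3fix: "t3 v = v" if "v \<in> transpositions A" for v
      unfolding t3_def t2fix[OF that] by (rule transposition_inv[OF that])
    have fixed: "t3 (s \<circ> w) = s \<circ> w"
      unfolding t3_def rev
      by (simp only: permutes_inv_comp[OF transposition_permutes[OF w] transposition_permutes[OF s]]
          transposition_inv[OF s] transposition_inv[OF w])
    have "t3 x = x" if "x permutes A" for x
      by (rule aut_fixing_products_trivial[OF fin card that t3 t3id t3fix
            aut_fixes_products[OF t3 t3id fin card t3fix s w ne fixed]])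
    then have "t2 x = inv' x" if "x permutes A" for x
      using that permutes_inv_inv[OF transposition_graph_aut_permutes[OF t2 that]]
      unfolding t3_def by metis
    then show thesis using that[OF g\<pi> \<pi>] t_eq by metis
  qed
qed

subsection \<open>Groups whose isometries are two-sided multiplications\<close>

text \<open>The inverse on \<open>b\<close> makes both parameters multiply in the order of
  composition as long as no inversion occurs. The flag \<open>e\<close> tells whether the argument
  is inverted first.\<close>

definition two_sided :: "('a, 'm) monoid_scheme \<Rightarrow> 'a \<Rightarrow> 'a \<Rightarrow> bool \<Rightarrow> 'a \<Rightarrow> 'a" where
  "two_sided G a b e =
     (\<lambda>x\<in>carrier G. a \<otimes>\<^bsub>G\<^esub> (if e then inv\<^bsub>G\<^esub> x else x) \<otimes>\<^bsub>G\<^esub> inv\<^bsub>G\<^esub> b)"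

section \<open>Composition and uniqueness of parameters in an arbitrary group\<close>

context group
begin

lemma mult_inv_cancel_left:
  assumes "a \<in> carrier G" "x \<in> carrier G"
  shows "a \<otimes> (inv a \<otimes> x) = x" "inv a \<otimes> (a \<otimes> x) = x"
  using assms by (simp_all add: m_assoc[symmetric])

lemma two_sided_apply:
  "x \<in> carrier G \<Longrightarrow> two_sided G a b e x = a \<otimes> (if e then inv x else x) \<otimes> inv b"
  by (simp add: two_sided_def)

lemma two_sided_funcset:
  "a \<in> carrier G \<Longrightarrow> b \<in> carrier G \<Longrightarrow> x \<in> carrier G \<Longrightarrow> two_sided G a b e x \<in> carrier G"
  by (simp add: two_sided_def)

text \<open>Inverting \<open>c \<otimes> x \<otimes> inv d\<close> gives
  \<open>d \<otimes> inv x \<otimes> inv c\<close>: an inversion in the outer map exchanges the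
  inner parameters. This is the coordinate swap of the wreath product.\<close>

lemma two_sided_compose:
  assumes "a \<in> carrier G" "b \<in> carrier G" "c \<in> carrier G" "d \<in> carrier G"
  shows "compose (carrier G) (two_sided G a b e) (two_sided G c d e') =
    (if e then two_sided G (a \<otimes> d) (b \<otimes> c) (\<not> e') else two_sided G (a \<otimes> c) (b \<otimes> d) e')"
  using assms
  by (auto simp: compose_def two_sided_def fun_eq_iff inv_mult_group m_assoc)

lemma two_sided_one: "two_sided G \<one> \<one> False = (\<lambda>x\<in>carrier G. x)"
  by (auto simp: two_sided_def fun_eq_iff)

lemma two_sided_Bij:
  assumes "a \<in> carrier G" "b \<in> carrier G"
  shows "two_sided G a b e \<in> Bij (carrier G)"
proof -
  \<comment> \<open>Solving \<open>y = a \<otimes> inv x \<otimes> inv b\<close> for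
    \<open>x\<close> gives \<open>inv b \<otimes> inv y \<otimes> a\<close>, so the parameters trade
    places when \<open>e\<close> holds.\<close>
  define g where "g = (if e then two_sided G (inv b) (inv a) True else two_sided G (inv a) (inv b) False)"
  have "bij_betw (two_sided G a b e) (carrier G) (carrier G)"
  proof (rule bij_betw_byWitness[where f' = g])
    show "\<forall>x\<in>carrier G. g (two_sided G a b e x) = x"
      using assms by (auto simp: g_def two_sided_def inv_mult_group m_assoc mult_inv_cancel_left)
    show "\<forall>x\<in>carrier G. two_sided G a b e (g x) = x"
      using assms by (auto simp: g_def two_sided_def inv_mult_group m_assoc mult_inv_cancel_left)
  qed (use assms in \<open>auto simp: g_def two_sided_funcset\<close>)
  then show ?thesis by (simp add: Bij_def two_sided_def)
qed

text \<open>Evaluation at \<open>\<one>\<close> shows \<open>a = c \<otimes> g\<close> and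
  \<open>b = d \<otimes> g\<close> for a common \<open>g\<close>; what remains is a statement about
  conjugation by \<open>g\<close>.\<close>

lemma two_sided_eq_iff:
  assumes center: "\<And>a. a \<in> carrier G \<Longrightarrow> (\<And>x. x \<in> carrier G \<Longrightarrow> a \<otimes> x = x \<otimes> a) \<Longrightarrow> a = \<one>"
    and nontrivial: "carrier G \<noteq> {\<one>}"
    and cl: "a \<in> carrier G" "b \<in> carrier G" "c \<in> carrier G" "d \<in> carrier G"
  shows "two_sided G a b e = two_sided G c d e' \<longleftrightarrow> a = c \<and> b = d \<and> e = e'"
proof
  assume eq: "two_sided G a b e = two_sided G c d e'"
  define g where "g = inv c \<otimes> a"
  have g: "g \<in> carrier G" using cl by (simp add: g_def)
  have a: "a = c \<otimes> g" using cl by (simp add: g_def m_assoc[symmetric])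
  have "a \<otimes> inv b = c \<otimes> inv d"
    using fun_cong[OF eq, of \<one>] cl by (simp add: two_sided_def split: if_splits)
  then have "g \<otimes> inv b = inv d"
    using cl g by (simp add: a m_assoc)
  then have b: "inv b = inv g \<otimes> inv d"
    using cl g by (metis inv_closed inv_solve_left)
  have conj: "g \<otimes> (if e then inv x else x) \<otimes> inv g = (if e' then inv x else x)"
    if x: "x \<in> carrier G" for x
  proof -
    let ?y = "if e then inv x else x" and ?z = "if e' then inv x else x"
    have yz: "?y \<in> carrier G" "?z \<in> carrier G" using x by auto
    have "c \<otimes> g \<otimes> ?y \<otimes> (inv g \<otimes> inv d) = c \<otimes> ?z \<otimes> inv d"
      using fun_cong[OF eq, of x] unfolding two_sided_apply[OF x] a b .
    then have "c \<otimes> (g \<otimes> ?y \<otimes> inv g) \<otimes> inv d = c \<otimes> ?z \<otimes> inv d"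
      using cl g yz by (simp only: m_assoc inv_closed m_closed)
    then show ?thesis using cl g yz by (simp only: right_cancel Units_eq Units_l_cancel inv_closed m_closed)
  qed
  \<comment> \<open>With different flags, inversion would be conjugation by \<open>g\<close> and
    hence a homomorphism. The group would then be commutative, so trivial by
    \<open>center\<close>.\<close>
  have "e = e'"
  proof (rule ccontr)
    assume "e \<noteq> e'"
    then have inv_eq: "inv x = g \<otimes> x \<otimes> inv g" if "x \<in> carrier G" for x
      using conj[OF that] conj[of "inv x"] that by (cases e) auto
    have "x \<otimes> y = y \<otimes> x" if xy: "x \<in> carrier G" "y \<in> carrier G" for x y
    proof -
      have "inv (x \<otimes> y) = (g \<otimes> x \<otimes> inv g) \<otimes> (g \<otimes> y \<otimes> inv g)"
        using inv_eq[of "x \<otimes> y"] xy g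
        by (simp add: m_assoc mult_inv_cancel_left)
      also have "\<dots> = inv x \<otimes> inv y" using inv_eq xy by simp
      also have "\<dots> = inv (y \<otimes> x)" using xy by (simp add: inv_mult_group)
      finally show ?thesis using xy by (metis inv_inv m_closed)
    qed
    then have "carrier G \<subseteq> {\<one>}" using center by blast
    then show False using nontrivial one_closed by auto
  qed
  then have "g \<otimes> x = x \<otimes> g" if x: "x \<in> carrier G" for x
  proof -
    have "g \<otimes> x \<otimes> inv g = x"
      using conj[OF x] conj[of "inv x"] \<open>e = e'\<close> x by (cases e) auto
    then show ?thesis using x g by (metis inv_solve_right m_closed)
  qed
  then have "g = \<one>" by (rule center[OF g])
  then show "a = c \<and> b = d \<and> e = e'"
    using a b cl \<open>e = e'\<close> by (simp add: inv_eq_1_iff) (metis inv_inv)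
qed simp

lemma two_sided_isometry:
  assumes "Metric_space (carrier G) D" and bi: "bi_invariant G D"
    and cl: "a \<in> carrier G" "b \<in> carrier G" "x \<in> carrier G" "y \<in> carrier G"
  shows "D (two_sided G a b e x) (two_sided G a b e y) = D x y"
proof -
  interpret Metric_space "carrier G" D by fact
  have left: "D (c \<otimes> u) (c \<otimes> v) = D u v" and right: "D (u \<otimes> c) (v \<otimes> c) = D u v"
    if "c \<in> carrier G" "u \<in> carrier G" "v \<in> carrier G" for c u v
    using bi that unfolding bi_invariant_def left_invariant_def right_invariant_def by metis+
  \<comment> \<open>Multiplying by \<open>x\<close> on the left and by \<open>y\<close> on the right
    turns the pair \<open>inv x\<close>, \<open>inv y\<close> into \<open>y\<close>,
    \<open>x\<close>; symmetry of \<open>D\<close> does the rest.\<close>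
  have "D (inv x) (inv y) = D (x \<otimes> inv x \<otimes> y) (x \<otimes> inv y \<otimes> y)"
    using left[of x "inv x" "inv y"] right[of y "x \<otimes> inv x" "x \<otimes> inv y"] cl by simp
  also have "\<dots> = D x y" using cl commute by (simp add: m_assoc)
  finally have "D (inv x) (inv y) = D x y" .
  then show ?thesis using cl left right by (simp add: two_sided_apply)
qed

end

text \<open>These three facts determine the group structure formally. The symmetric group enters
  only when the locale is interpreted.\<close>

locale two_sided_isometries = group G for G :: "('a, 'm) monoid_scheme" (structure) +
  fixes D :: "'a \<Rightarrow> 'a \<Rightarrow> real"
  assumes trivial_center:
    "\<And>a. a \<in> carrier G \<Longrightarrow> (\<And>x. x \<in> carrier G \<Longrightarrow> a \<otimes> x = x \<otimes> a) \<Longrightarrow> a = \<one>"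
    and nontrivial: "carrier G \<noteq> {\<one>}"
    and isometries: "carrier (isometry_group (carrier G) D) =
      {two_sided G a b e |a b e. a \<in> carrier G \<and> b \<in> carrier G}"
begin

abbreviation "Iso \<equiv> isometry_group (carrier G) D"
abbreviation "L \<equiv> left_multiplications G"
abbreviation "R \<equiv> right_multiplications G"
abbreviation "I \<equiv> inversion_group G"

sublocale Iso: group Iso
  by (rule group_isometry_group)

lemmas eq_iff = two_sided_eq_iff[OF trivial_center nontrivial]

lemma two_sided_in_Iso [simp]:
  "a \<in> carrier G \<Longrightarrow> b \<in> carrier G \<Longrightarrow> two_sided G a b e \<in> carrier Iso"
  unfolding isometries by blast

lemma Iso_cases:
  assumes "t \<in> carrier Iso"
  obtains a b e where "a \<in> carrier G" "b \<in> carrier G" "t = two_sided G a b e"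
  using assms unfolding isometries by blast

lemma Iso_one: "\<one>\<^bsub>Iso\<^esub> = two_sided G \<one> \<one> False"
  by (simp add: isometry_group_def BijGroup_def two_sided_one)

lemma Iso_mult:
  assumes "a \<in> carrier G" "b \<in> carrier G" "c \<in> carrier G" "d \<in> carrier G"
  shows "two_sided G a b e \<otimes>\<^bsub>Iso\<^esub> two_sided G c d e' =
    (if e then two_sided G (a \<otimes> d) (b \<otimes> c) (\<not> e') else two_sided G (a \<otimes> c) (b \<otimes> d) e')"
  using assms two_sided_compose[OF assms, of e e']
  by (simp add: isometry_group_def BijGroup_def two_sided_Bij)

lemma Iso_inv:
  assumes "a \<in> carrier G" "b \<in> carrier G"
  shows "inv\<^bsub>Iso\<^esub> (two_sided G a b e) =
    (if e then two_sided G (inv b) (inv a) True else two_sided G (inv a) (inv b) False)"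
  using assms by (intro Iso.inv_equality) (auto simp: Iso_mult Iso_one)

lemma left_multiplications_eq: "L = {two_sided G a \<one> False |a. a \<in> carrier G}"
proof -
  have "two_sided G a \<one> False = (\<lambda>x\<in>carrier G. a \<otimes> x)" if "a \<in> carrier G" for a
    using that by (auto simp: two_sided_def fun_eq_iff)
  then show ?thesis unfolding left_multiplications_def by force
qed

lemma right_multiplications_eq: "R = {two_sided G \<one> b False |b. b \<in> carrier G}"
proof -
  have "two_sided G \<one> b False = (\<lambda>x\<in>carrier G. x \<otimes> inv b)" if "b \<in> carrier G" for b
    using that by (auto simp: two_sided_def fun_eq_iff)
  then show ?thesis unfolding right_multiplications_def by force
qed

lemma left_right_multiplications_eq:
  "L <#>\<^bsub>Iso\<^esub> R = {two_sided G a b False |a b. a \<in> carrier G \<and> b \<in> carrier G}" (is "_ = ?N")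
proof
  show "L <#>\<^bsub>Iso\<^esub> R \<subseteq> ?N"
    unfolding set_mult_def left_multiplications_eq right_multiplications_eq
    by (fastforce simp: Iso_mult)
  have "two_sided G a b False = two_sided G a \<one> False \<otimes>\<^bsub>Iso\<^esub> two_sided G \<one> b False"
    if "a \<in> carrier G" "b \<in> carrier G" for a b
    using that by (simp add: Iso_mult)
  then show "?N \<subseteq> L <#>\<^bsub>Iso\<^esub> R"
    unfolding set_mult_def left_multiplications_eq right_multiplications_eq by blast
qed

lemma inversion_group_eq: "I = {two_sided G \<one> \<one> False, two_sided G \<one> \<one> True}"
proof -
  let ?B = "BijGroup (carrier G)" and ?j = "two_sided G \<one> \<one> True"
  interpret B: group ?B by (rule group_BijGroup)
  have j: "inversion_map G = ?j"
    by (auto simp: inversion_map_def two_sided_def fun_eq_iff)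
  have jB: "?j \<in> carrier ?B" by (simp add: BijGroup_def two_sided_Bij)
  have one: "\<one>\<^bsub>?B\<^esub> = two_sided G \<one> \<one> False" by (simp add: BijGroup_def two_sided_one)
  have jj: "?j \<otimes>\<^bsub>?B\<^esub> ?j = \<one>\<^bsub>?B\<^esub>"
    unfolding one by (simp add: BijGroup_def two_sided_Bij two_sided_compose)
  then have inv: "inv\<^bsub>?B\<^esub> ?j = ?j" using jB by (simp add: B.inv_equality)
  have "x \<in> {\<one>\<^bsub>?B\<^esub>, ?j}" if "x \<in> generate ?B {?j}" for x
    using that by (induction rule: generate.induct) (use jB jj inv in auto)
  then have "generate ?B {?j} = {\<one>\<^bsub>?B\<^esub>, ?j}"
    by (auto intro: generate.intros)
  then show ?thesis unfolding inversion_group_def j one .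
qed

lemma subgroup_left: "subgroup L Iso"
  unfolding left_multiplications_eq
  by (rule Iso.subgroupI) (fastforce simp: Iso_inv Iso_mult)+

lemma subgroup_right: "subgroup R Iso"
  unfolding right_multiplications_eq
  by (rule Iso.subgroupI) (fastforce simp: Iso_inv Iso_mult)+

text \<open>An isometry and its inverse carry the same flag, so conjugating a map without inversion
  gives a map without inversion.\<close>

lemma normal_left_right: "L <#>\<^bsub>Iso\<^esub> R \<lhd> Iso"
  unfolding left_right_multiplications_eq
proof (rule Iso.normal_invI)
  show "subgroup {two_sided G a b False |a b. a \<in> carrier G \<and> b \<in> carrier G} Iso"
    by (rule Iso.subgroupI) (fastforce simp: Iso_inv Iso_mult)+
next
  fix t h assume "t \<in> carrier Iso" "h \<in> {two_sided G a b False |a b. a \<in> carrier G \<and> b \<in> carrier G}"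
  then show "t \<otimes>\<^bsub>Iso\<^esub> h \<otimes>\<^bsub>Iso\<^esub> inv\<^bsub>Iso\<^esub> t \<in> {two_sided G a b False |a b. a \<in> carrier G \<and> b \<in> carrier G}"
    by (elim Iso_cases) (fastforce simp: Iso_inv Iso_mult)
qed

text \<open>Normality is asserted inside the product of \<open>L\<close> and \<open>R\<close>, since
  in the whole group inversion conjugates left multiplications into right ones. The trivial
  intersection comes from uniqueness of the parameters.\<close>

lemma direct_product:
  "is_internal_direct_product (Iso\<lparr>carrier := L <#>\<^bsub>Iso\<^esub> R\<rparr>) L R"
proof -
  let ?N = "L <#>\<^bsub>Iso\<^esub> R"
  let ?K = "Iso\<lparr>carrier := ?N\<rparr>"
  have N: "subgroup ?N Iso" using normal_left_right by (simp add: normal_def)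
  interpret K: group ?K by (rule Iso.subgroup_imp_group[OF N])
  have sub: "L \<subseteq> ?N" "R \<subseteq> ?N"
    unfolding left_right_multiplications_eq
    unfolding left_multiplications_eq right_multiplications_eq by auto
  have inv: "inv\<^bsub>?K\<^esub> t = inv\<^bsub>Iso\<^esub> t" if "t \<in> ?N" for t
    using Iso.m_inv_consistent[OF N that] .
  have "L \<lhd> ?K"
  proof (rule K.normal_invI)
    show "subgroup L ?K" by (rule Iso.subgroup_incl[OF subgroup_left N sub(1)])
    fix t h assume t: "t \<in> carrier ?K" and h: "h \<in> L"
    then have t': "t \<in> ?N" by simp
    then have "t \<otimes>\<^bsub>Iso\<^esub> h \<otimes>\<^bsub>Iso\<^esub> inv\<^bsub>Iso\<^esub> t \<in> L"
      using h unfolding left_right_multiplications_eq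
      unfolding left_multiplications_eq by (fastforce simp: Iso_inv Iso_mult)
    then show "t \<otimes>\<^bsub>?K\<^esub> h \<otimes>\<^bsub>?K\<^esub> inv\<^bsub>?K\<^esub> t \<in> L"
      by (simp add: inv[OF t'])
  qed
  moreover have "R \<lhd> ?K"
  proof (rule K.normal_invI)
    show "subgroup R ?K" by (rule Iso.subgroup_incl[OF subgroup_right N sub(2)])
    fix t h assume t: "t \<in> carrier ?K" and h: "h \<in> R"
    then have t': "t \<in> ?N" by simp
    then have "t \<otimes>\<^bsub>Iso\<^esub> h \<otimes>\<^bsub>Iso\<^esub> inv\<^bsub>Iso\<^esub> t \<in> R"
      using h unfolding left_right_multiplications_eq
      unfolding right_multiplications_eq by (fastforce simp: Iso_inv Iso_mult)
    then show "t \<otimes>\<^bsub>?K\<^esub> h \<otimes>\<^bsub>?K\<^esub> inv\<^bsub>?K\<^esub> t \<in> R"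
      by (simp add: inv[OF t'])
  qed
  moreover have "L \<inter> R = {\<one>\<^bsub>?K\<^esub>}"
    unfolding left_multiplications_eq right_multiplications_eq
    by (auto simp: Iso_one eq_iff)
  ultimately show ?thesis
    unfolding is_internal_direct_product_def by (simp add: set_mult_def)
qed

lemma semidirect: "is_internal_semidirect_product Iso (L <#>\<^bsub>Iso\<^esub> R) I"
proof -
  have I: "subgroup I Iso"
    unfolding inversion_group_eq by (rule Iso.subgroupI) (auto simp: Iso_inv Iso_mult)
  have "(L <#>\<^bsub>Iso\<^esub> R) \<inter> I = {\<one>\<^bsub>Iso\<^esub>}"
    unfolding left_right_multiplications_eq inversion_group_eq by (auto simp: Iso_one eq_iff)
  moreover have "(L <#>\<^bsub>Iso\<^esub> R) <#>\<^bsub>Iso\<^esub> I = carrier Iso"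
  proof
    show "(L <#>\<^bsub>Iso\<^esub> R) <#>\<^bsub>Iso\<^esub> I \<subseteq> carrier Iso"
      using subgroup.subset[OF normal_imp_subgroup[OF normal_left_right]] subgroup.subset[OF I]
      by (rule Iso.set_mult_closed)
    show "carrier Iso \<subseteq> (L <#>\<^bsub>Iso\<^esub> R) <#>\<^bsub>Iso\<^esub> I"
    proof
      fix t assume "t \<in> carrier Iso"
      then obtain a b e where t: "a \<in> carrier G" "b \<in> carrier G" "t = two_sided G a b e"
        by (rule Iso_cases)
      have "two_sided G a b False \<in> L <#>\<^bsub>Iso\<^esub> R"
        unfolding left_right_multiplications_eq using t by blast
      moreover have "two_sided G \<one> \<one> e \<in> I"
        unfolding inversion_group_eq by (cases e) auto
      moreover have "t = two_sided G a b False \<otimes>\<^bsub>Iso\<^esub> two_sided G \<one> \<one> e"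
        using t by (simp add: Iso_mult)
      ultimately show "t \<in> (L <#>\<^bsub>Iso\<^esub> R) <#>\<^bsub>Iso\<^esub> I"
        unfolding set_mult_def[of Iso "L <#>\<^bsub>Iso\<^esub> R"] by blast
    qed
  qed
  ultimately show ?thesis
    using normal_left_right I unfolding is_internal_semidirect_product_def by blast
qed

text \<open>The two coordinates become the left and right parameters, and the top permutation
  becomes the inversion flag. Under this dictionary \<open>Iso_mult\<close> is the multiplication of
  the wreath product.\<close>

lemma iso_wreath: "Iso \<cong> wreath_product G 2"
proof -
  let ?W = "wreath_product G 2"
  have I2: "{1..2} = {1, 2::nat}" by auto
  define s :: "nat \<Rightarrow> nat" where "s = Transposition.transpose 1 2"
  have sp: "s permutes {1..2}" unfolding s_def by (rule permutes_swap_id) auto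
  have s12: "s (Suc 0) = 2" "s 2 = Suc 0" by (auto simp: s_def)
  have ss: "s \<circ> s = id" by (simp add: s_def)
  have sid: "s \<noteq> id" using s12(1) by auto
  have S2: "\<sigma> = id \<or> \<sigma> = s" if "\<sigma> permutes {1..2}" for \<sigma>
    using that unfolding I2 permutes_doubleton_iff s_def by blast
  have invs: "inv\<^bsub>sym_group 2\<^esub> s = s"
    using sym_group_inv_equality[of s 2] sp inv_transpose_eq[of 1 "2::nat"]
    unfolding sym_group_carrier s_def by (simp only:)
  have invid: "inv\<^bsub>sym_group 2\<^esub> id = id"
    by (metis group.is_monoid monoid.inv_one sym_group_is_group sym_group_one)
  have W: "carrier ?W = {(f, \<sigma>). f \<in> {1..2} \<rightarrow>\<^sub>E carrier G \<and> \<sigma> permutes {1..2}}"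
    by (auto simp: wreath_product_def semidirect_product_def sym_group_carrier)
  \<comment> \<open>Both elements of the top group are involutions, so the inverse in
    \<open>wreath_action\<close> disappears.\<close>
  have act: "wreath_action G 2 \<sigma> g = (\<lambda>i\<in>{1..2}. if \<sigma> = id then g i else g (s i))"
    if "g \<in> {1..2} \<rightarrow>\<^sub>E carrier G" "\<sigma> permutes {1..2}" for g \<sigma>
    using that S2[OF that(2)]
    by (auto simp: wreath_action_def sid invs invid intro!: restrict_ext)
  have mult: "(f, \<sigma>) \<otimes>\<^bsub>?W\<^esub> (g, \<tau>) =
      ((\<lambda>i\<in>{1..2}. f i \<otimes> (if \<sigma> = id then g i else g (s i))), \<sigma> \<circ> \<tau>)"
    if "g \<in> {1..2} \<rightarrow>\<^sub>E carrier G" "\<sigma> permutes {1..2}" for f g \<sigma> \<tau>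
    using that
    by (auto simp: wreath_product_def semidirect_product_def sym_group_mult act intro!: restrict_ext)
  define h where "h = (\<lambda>(f, \<sigma>). two_sided G (f 1) (f (2::nat)) (\<sigma> \<noteq> (id :: nat \<Rightarrow> nat)))"
  have "h \<in> hom ?W Iso"
  proof (rule homI)
    show "h p \<in> carrier Iso" if "p \<in> carrier ?W" for p
      using that unfolding W by (auto simp: h_def PiE_iff)
    fix p q assume pq: "p \<in> carrier ?W" "q \<in> carrier ?W"
    obtain f \<sigma> where p: "p = (f, \<sigma>)" "f \<in> {1..2} \<rightarrow>\<^sub>E carrier G" "\<sigma> permutes {1..2}"
      using pq(1) unfolding W by blast
    obtain g \<tau> where q: "q = (g, \<tau>)" "g \<in> {1..2} \<rightarrow>\<^sub>E carrier G" "\<tau> permutes {1..2}"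
      using pq(2) unfolding W by blast
    have cl: "f 1 \<in> carrier G" "f 2 \<in> carrier G" "g 1 \<in> carrier G" "g 2 \<in> carrier G"
      using p(2) q(2) by (auto simp: PiE_iff)
    show "h (p \<otimes>\<^bsub>?W\<^esub> q) = h p \<otimes>\<^bsub>Iso\<^esub> h q"
      using S2[OF p(3)] S2[OF q(3)] cl
      by (auto simp: p(1) q(1) mult[OF q(2) p(3)] h_def Iso_mult sid s12 ss)
  qed
  moreover have "bij_betw h (carrier ?W) (carrier Iso)"
  proof (rule bij_betw_imageI)
    show "inj_on h (carrier ?W)"
    proof (rule inj_onI)
      fix p q assume pq: "p \<in> carrier ?W" "q \<in> carrier ?W" and eq: "h p = h q"
      obtain f \<sigma> where p: "p = (f, \<sigma>)" "f \<in> {1..2} \<rightarrow>\<^sub>E carrier G" "\<sigma> permutes {1..2}"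
        using pq(1) unfolding W by blast
      obtain g \<tau> where q: "q = (g, \<tau>)" "g \<in> {1..2} \<rightarrow>\<^sub>E carrier G" "\<tau> permutes {1..2}"
        using pq(2) unfolding W by blast
      have cl: "f 1 \<in> carrier G" "f 2 \<in> carrier G" "g 1 \<in> carrier G" "g 2 \<in> carrier G"
        using p(2) q(2) by (auto simp: PiE_iff)
      have *: "f 1 = g 1" "f 2 = g 2" "\<sigma> \<noteq> id \<longleftrightarrow> \<tau> \<noteq> id"
        using eq cl by (auto simp: h_def p(1) q(1) eq_iff)
      have "f = g"
      proof (rule PiE_ext[OF p(2) q(2)])
        fix i :: nat assume "i \<in> {1..2}"
        then have "i = 1 \<or> i = 2" unfolding I2 by simp
        then show "f i = g i" using * by blast
      qed
      then show "p = q" using * S2[OF p(3)] S2[OF q(3)] p(1) q(1) by auto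
    qed
    show "h ` carrier ?W = carrier Iso"
    proof
      show "h ` carrier ?W \<subseteq> carrier Iso"
        unfolding W by (auto simp: h_def PiE_iff)
      show "carrier Iso \<subseteq> h ` carrier ?W"
      proof
        fix t assume "t \<in> carrier Iso"
        then obtain a b e where t: "a \<in> carrier G" "b \<in> carrier G" "t = two_sided G a b e"
          by (rule Iso_cases)
        define p where "p = ((\<lambda>i\<in>{1..2::nat}. if i = 1 then a else b), if e then s else id)"
        have "p \<in> carrier ?W" unfolding W p_def using t sp by (auto simp: permutes_id)
        moreover have "h p = t" unfolding p_def h_def using t sid by auto
        ultimately show "t \<in> h ` carrier ?W" by blast
      qed
    qed
  qed
  ultimately have "h \<in> iso ?W Iso" by (simp add: iso_def)
  then have "?W \<cong> Iso" by (auto simp: is_iso_def)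
  then show ?thesis
    using group.iso_sym[OF group_wreath_product[OF is_group]] by blast
qed

end

subsection \<open>The symmetric group\<close>

lemma is_transposition_iff: "is_transposition n \<pi> \<longleftrightarrow> \<pi> \<in> transpositions {1..n}"
  unfolding is_transposition_def transpositions_def by blast

text \<open>If \<open>p\<close> moved \<open>i\<close>, commuting with \<open>transpose i k\<close>
  for a point \<open>k\<close> outside \<open>{i, p i}\<close> would force
  \<open>p k = p i\<close>.\<close>

lemma sym_group_trivial_center:
  fixes n :: nat
  assumes n: "n \<ge> 3" and p: "p permutes {1..n}"
    and comm: "\<And>x. x permutes {1..n} \<Longrightarrow> p \<circ> x = x \<circ> p"
  shows "p = id"
proof (rule ccontr)
  assume "p \<noteq> id"
  then obtain i where i: "p i \<noteq> i" by (auto simp: fun_eq_iff)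
  then have iA: "i \<in> {1..n}" using permutes_not_in[OF p] by blast
  then have piA: "p i \<in> {1..n}" using permutes_in_image[OF p] by simp
  have "\<not> {1..n} \<subseteq> {i, p i}" using card_mono[of "{i, p i}" "{1..n}"] n i by auto
  then obtain k where k: "k \<in> {1..n}" "k \<noteq> i" "k \<noteq> p i" by blast
  have "p \<circ> transpose i k = transpose i k \<circ> p"
    by (rule comm[OF permutes_swap_id[OF iA k(1)]])
  from fun_cong[OF this, of i] have "p k = p i" using i k by simp
  then show False using permutes_inj[OF p] k by (auto simp: inj_eq)
qed

lemma sym_group_isometries:
  assumes n: "n \<ge> 3" and M: "Metric_space (carrier (sym_group n)) D"
    and bi: "bi_invariant (sym_group n) D" and dist: "distinguishes_transpositions n D"
  shows "carrier (isometry_group (carrier (sym_group n)) D) =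
    {two_sided (sym_group n) a b e |a b e. a \<in> carrier (sym_group n) \<and> b \<in> carrier (sym_group n)}"
    (is "_ = ?T")
proof
  let ?G = "sym_group n" and ?A = "{1..n}"
  interpret G: group ?G by (rule sym_group_is_group)
  have carr: "x \<in> carrier ?G \<longleftrightarrow> x permutes ?A" for x by (rule sym_group_carrier)
  have inv: "inv\<^bsub>?G\<^esub> x = inv' x" if "x permutes ?A" for x
    using that by (simp add: carr)
  show "?T \<subseteq> carrier (isometry_group (carrier ?G) D)"
    using G.two_sided_isometry[OF M bi]
    by (auto simp: isometry_group_def G.two_sided_Bij)
  show "carrier (isometry_group (carrier ?G) D) \<subseteq> ?T"
  proof
    fix t assume "t \<in> carrier (isometry_group (carrier ?G) D)"
    then have t: "t \<in> Bij (carrier ?G)"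
      and iso: "\<And>x y. x \<in> carrier ?G \<Longrightarrow> y \<in> carrier ?G \<Longrightarrow> D (t x) (t y) = D x y"
      by (auto simp: isometry_group_def)
    obtain c where "\<forall>x\<in>carrier ?G. \<forall>y\<in>carrier ?G.
        D x y = c \<longleftrightarrow> is_transposition n (x \<otimes>\<^bsub>?G\<^esub> inv\<^bsub>?G\<^esub> y)"
      using dist unfolding distinguishes_transpositions_def by blast
    \<comment> \<open>Distance \<open>c\<close> marks exactly the edges of the transposition graph,
      so an isometry is a graph automorphism.\<close>
    then have c: "D x y = c \<longleftrightarrow> x \<circ> inv' y \<in> transpositions ?A"
      if "x permutes ?A" "y permutes ?A" for x y
      using that[folded carr] inv[OF that(2)]
      unfolding is_transposition_iff sym_group_mult by metis
    have perm: "t x permutes ?A" if "x permutes ?A" for x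
      using Bij_imp_funcset[OF t] that by (auto simp: carr)
    have carr_eq: "carrier ?G = {x. x permutes ?A}" using carr by auto
    have "transposition_graph_aut ?A t"
      unfolding transposition_graph_aut_def
    proof (intro conjI allI impI)
      show "bij_betw t {p. p permutes ?A} {p. p permutes ?A}"
        using t unfolding Bij_def carr_eq by blast
      fix p q :: "nat \<Rightarrow> nat" assume "p permutes ?A" "q permutes ?A"
      then show "t p \<circ> inv' (t q) \<in> transpositions ?A \<longleftrightarrow> p \<circ> inv' q \<in> transpositions ?A"
        using c[of p q] c[of "t p" "t q"] perm iso[of p q] unfolding carr by simp
    qed
    then obtain p q where pq: "p permutes ?A" "q permutes ?A"
      and cases: "(\<forall>x. x permutes ?A \<longrightarrow> t x = p \<circ> x \<circ> inv' q) \<or>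
        (\<forall>x. x permutes ?A \<longrightarrow> t x = p \<circ> inv' x \<circ> inv' q)"
      by (rule transposition_graph_aut_cases) (use n in auto)
    from cases have "\<exists>e. \<forall>x\<in>carrier ?G. t x = two_sided ?G p q e x"
    proof
      assume "\<forall>x. x permutes ?A \<longrightarrow> t x = p \<circ> x \<circ> inv' q"
      then show ?thesis
        by (intro exI[of _ False])
          (simp add: G.two_sided_apply carr sym_group_mult inv[OF pq(2)])
    next
      assume "\<forall>x. x permutes ?A \<longrightarrow> t x = p \<circ> inv' x \<circ> inv' q"
      then show ?thesis
        by (intro exI[of _ True])
          (simp add: G.two_sided_apply carr sym_group_mult inv inv[OF pq(2)])
    qed
    then obtain e where "\<forall>x\<in>carrier ?G. t x = two_sided ?G p q e x" by blast
    \<comment> \<open>Agreement on the carrier suffices, because both maps are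
      \<open>undefined\<close> outside it.\<close>
    then have "t = two_sided ?G p q e"
      using Bij_imp_extensional[OF t]
      by (intro extensionalityI[of t "carrier ?G"]) (auto simp: two_sided_def)
    then show "t \<in> ?T" using pq carr by blast
  qed
qed

theorem theorem1:
  fixes n :: nat and D :: "(nat \<Rightarrow> nat) \<Rightarrow> (nat \<Rightarrow> nat) \<Rightarrow> real"
  defines "Iso \<equiv> isometry_group (carrier (sym_group n)) D"
    and "L \<equiv> left_multiplications (sym_group n)"
    and "R \<equiv> right_multiplications (sym_group n)"
    and "I \<equiv> inversion_group (sym_group n)"
  assumes "n \<ge> 3"
    and "Metric_space (carrier (sym_group n)) D"
    and "bi_invariant (sym_group n) D"
    and "distinguishes_transpositions n D"
  shows "is_internal_direct_product (Iso\<lparr>carrier := L <#>\<^bsub>Iso\<^esub> R\<rparr>) L R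
       \<and> is_internal_semidirect_product Iso (L <#>\<^bsub>Iso\<^esub> R) I
       \<and> Iso \<cong> wreath_product (sym_group n) 2"
proof -
  let ?G = "sym_group n"
  have "two_sided_isometries ?G D"
  proof (intro two_sided_isometries.intro two_sided_isometries_axioms.intro sym_group_is_group)
    show "a = \<one>\<^bsub>?G\<^esub>"
      if "a \<in> carrier ?G" "\<And>x. x \<in> carrier ?G \<Longrightarrow> a \<otimes>\<^bsub>?G\<^esub> x = x \<otimes>\<^bsub>?G\<^esub> a" for a
      using sym_group_trivial_center[OF \<open>n \<ge> 3\<close>, of a] that
      unfolding sym_group_carrier sym_group_mult sym_group_one by blast
    have "transpose 1 2 \<in> carrier ?G"
      unfolding sym_group_carrier using \<open>n \<ge> 3\<close> by (intro permutes_swap_id) auto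
    moreover have "transpose 1 2 \<noteq> (id :: nat \<Rightarrow> nat)" by (simp add: transpose_eq_id_iff)
    ultimately show "carrier ?G \<noteq> {\<one>\<^bsub>?G\<^esub>}" unfolding sym_group_one by blast
    show "carrier (isometry_group (carrier ?G) D) =
        {two_sided ?G a b e |a b e. a \<in> carrier ?G \<and> b \<in> carrier ?G}"
      by (rule sym_group_isometries) fact+
  qed
  then interpret two_sided_isometries ?G D .
  show ?thesis
    unfolding Iso_def L_def R_def I_def
    using direct_product semidirect iso_wreath by blast
qed

end
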